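(* Let $\alpha_1,\alpha_2>-1$ and $\alpha>-\min(1,1+\alpha_1,1+\alpha_2)$, and let $\{m^{\rm J}_{p,0}\}_{p\ge0}$ be the limiting moments of the Jacobi $\beta$-ensemble with $\beta=2\alpha/N$ (see context). Then $m^{\rm J}_{0,0}=1$ and, for all integers $p\ge1$, $$m_{p,0}^{\rm J}=\frac{1}{p+1+\alpha_1+\alpha_2+2\alpha}\Big((1+\alpha_1+\alpha)-\alpha_2\sum_{s=1}^{p-1}m_{s,0}^{\rm J}-\alpha\sum_{s=1}^{p-1}m_{s,0}^{\rm J}\,m_{p-s,0}^{\rm J}\Big).$$
   Context: The Jacobi $\beta$-ensemble is the probability density on $(0,1)^N$ proportional to $\prod_{l=1}^N\lambda_l^{\alpha_1}(1-\lambda_l)^{\alpha_2}\prod_{1\le j<k\le N}|\lambda_k-\lambda_j|^\beta$. Here $\beta=2\alpha/N$ with $\alpha,\alpha_1,\alpha_2$ fixed, and $N\to\infty$. Standing assumption (large-$N$ ansatz): for every $n\ge1$ and all integers $p_1,\dots,p_n\ge0$, the joint cumulant of $\sum_j\lambda_j^{p_1},\dots,\sum_j\lambda_j^{p_n}$ (with $\beta=2\alpha/N$) has, as $N\to\infty$, an asymptotic expansion $N\sum_{l\ge0}c^{(l)}_{p_1,\dots,p_n}N^{-l}$ with coefficients independent of $N$. $m^{\rm J}_{p,0}=\lim_{N\to\infty}\frac1N\big\langle\sum_{j=1}^N\lambda_j^p\big\rangle$. Empty sums are zero. *)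

theory Defs
  imports "HOL-Probability.Probability" "HOL-Library.Landau_Symbols"
begin

definition jacobi_weight :: "real \<Rightarrow> real \<Rightarrow> real \<Rightarrow> nat \<Rightarrow> (nat \<Rightarrow> real) \<Rightarrow> real" where
  "jacobi_weight \<alpha>\<^sub>1 \<alpha>\<^sub>2 \<beta> N x =
     indicator (\<Pi>\<^sub>E l\<in>{..<N}. {0<..<1}) x *
     (\<Prod>l<N. x l powr \<alpha>\<^sub>1 * (1 - x l) powr \<alpha>\<^sub>2) *
     (\<Prod>k<N. \<Prod>j<k. \<bar>x k - x j\<bar> powr \<beta>)"

definition jacobi_ensemble :: "real \<Rightarrow> real \<Rightarrow> real \<Rightarrow> nat \<Rightarrow> (nat \<Rightarrow> real) measure" where
  "jacobi_ensemble \<alpha>\<^sub>1 \<alpha>\<^sub>2 \<beta> N =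
     (let L = (\<Pi>\<^sub>M l\<in>{..<N}. lborel);
          Z = (LINT y|L. jacobi_weight \<alpha>\<^sub>1 \<alpha>\<^sub>2 \<beta> N y)
      in density L (\<lambda>x. ennreal (jacobi_weight \<alpha>\<^sub>1 \<alpha>\<^sub>2 \<beta> N x / Z)))"

definition power_stat :: "nat \<Rightarrow> nat \<Rightarrow> (nat \<Rightarrow> real) \<Rightarrow> real" where
  "power_stat N p x = (\<Sum>j<N. x j ^ p)"

text \<open>The joint cumulant of the variables \<open>X 0, \<dots>, X (n - 1)\<close>, by the
  moments-to-cumulants formula over set partitions of the index set.\<close>

definition joint_cumulant :: "'a measure \<Rightarrow> nat \<Rightarrow> (nat \<Rightarrow> 'a \<Rightarrow> real) \<Rightarrow> real" where
  "joint_cumulant M n X =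
     (\<Sum>\<pi> | partition_on {..<n} \<pi>.
        (-1) ^ (card \<pi> - 1) * fact (card \<pi> - 1) *
        (\<Prod>B\<in>\<pi>. LINT x|M. (\<Prod>i\<in>B. X i x)))"

text \<open>Poincare asymptotic expansion \<open>f N \<sim> N * (c 0 + c 1 / N + c 2 / N\<^sup>2 + \<dots>)\<close>:
  truncating after the term of index \<open>K\<close> leaves an error of smaller order than that term's
  power of \<open>N\<close>.\<close>

definition has_large_N_expansion :: "(nat \<Rightarrow> real) \<Rightarrow> (nat \<Rightarrow> real) \<Rightarrow> bool" where
  "has_large_N_expansion f c \<longleftrightarrow>
     (\<forall>K. (\<lambda>N. f N - real N * (\<Sum>l\<le>K. c l / real N ^ l)) \<in> o(\<lambda>N. real N / real N ^ K))"

definition large_N_ansatz :: "real \<Rightarrow> real \<Rightarrow> real \<Rightarrow> bool" where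
  "large_N_ansatz \<alpha>\<^sub>1 \<alpha>\<^sub>2 \<alpha> \<longleftrightarrow>
     (\<forall>n\<ge>1. \<forall>p :: nat \<Rightarrow> nat. \<exists>c :: nat \<Rightarrow> real.
        has_large_N_expansion
          (\<lambda>N. joint_cumulant (jacobi_ensemble \<alpha>\<^sub>1 \<alpha>\<^sub>2 (2 * \<alpha> / real N) N) n
                  (\<lambda>i. power_stat N (p i)))
          c)"

definition jacobi_limit_moment :: "real \<Rightarrow> real \<Rightarrow> real \<Rightarrow> nat \<Rightarrow> real" where
  "jacobi_limit_moment \<alpha>\<^sub>1 \<alpha>\<^sub>2 \<alpha> p =
     lim (\<lambda>N. (1 / real N) *
       (LINT x|jacobi_ensemble \<alpha>\<^sub>1 \<alpha>\<^sub>2 (2 * \<alpha> / real N) N. power_stat N p x))"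

end

theory Submission imports Defs begin

text \<open>
  The weight is integrable because the pair product is dominated by a sum over centres \<open>c\<close> of star
  products \<open>\<Prod>k\<noteq>c. \<bar>x k - x c\<bar> powr \<alpha>\<close> when \<open>\<alpha> < 0\<close>, and a star integral factorises into
  one-dimensional integrals that converge when \<open>\<alpha> > - min 1 (1 + \<alpha>\<^sub>1) (1 + \<alpha>\<^sub>2)\<close>.
  Invariance of the partition function under the substitution \<open>x l \<mapsto> x l + t * x l ^ p * (1 - x l)\<close>,
  differentiated at \<open>t = 0\<close>, is the first loop equation, which relates the means of the power sums
  to the means of their pairwise products. By the ansatz covariances of power sums are \<open>O(N)\<close>, so
  after division by \<open>N\<close> the products factorise in the limit. The limit equation is quadratic in the
  moments, and summing it over \<open>p\<close> gives the recurrence.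
\<close>

section \<open>One-dimensional bounds and star products\<close>

lemma nn_integral_powr_unit_interval:
  fixes s :: real
  assumes "s < 1"
  shows "(\<integral>\<^sup>+x. ennreal (x powr - s) * indicator {0..1} x \<partial>lborel) = ennreal (1 / (1 - s))"
proof -
  have "((\<lambda>x. x powr - s) has_integral (1 powr (- s + 1) / (- s + 1))) {0..1::real}"
    using assms by (intro has_integral_powr_from_0) auto
  then show ?thesis
    by (intro nn_integral_has_integral_lebesgue') (auto simp: add.commute)
qed

text \<open>A shift carries the part right of \<open>c\<close> into \<open>{0..1}\<close> and a
  reflection the part left of it. The bound is uniform in \<open>c\<close>, which the star integral
  relies on.\<close>

lemma nn_integral_abs_powr_le:
  fixes s c :: real
  assumes "s < 1" "0 \<le> c" "c \<le> 1"
  shows "(\<integral>\<^sup>+x. ennreal (\<bar>x - c\<bar> powr - s) * indicator {0<..<1} x \<partial>lborel) \<le> ennreal (2 / (1 - s))"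
proof -
  let ?f = "\<lambda>x. ennreal (x powr - s) * indicator {0..1::real} x"
  have m[measurable]: "?f \<in> borel_measurable borel" by measurable
  have "(\<integral>\<^sup>+x. ennreal (\<bar>x - c\<bar> powr - s) * indicator {0<..<1} x \<partial>lborel)
      \<le> (\<integral>\<^sup>+x. ?f (- c + 1 * x) + ?f (c + (- 1) * x) \<partial>lborel)"
    using assms(2,3) by (intro nn_integral_mono) (auto simp: indicator_def abs_if)
  also have "\<dots> = (\<integral>\<^sup>+x. ?f (- c + 1 * x) \<partial>lborel) + (\<integral>\<^sup>+x. ?f (c + (- 1) * x) \<partial>lborel)"
    by (rule nn_integral_add) measurable
  also have "(\<integral>\<^sup>+x. ?f (- c + 1 * x) \<partial>lborel) = integral\<^sup>N lborel ?f"
    using nn_integral_real_affine[OF m, of 1 "- c"] by (simp only:) simp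
  also have "(\<integral>\<^sup>+x. ?f (c + (- 1) * x) \<partial>lborel) = integral\<^sup>N lborel ?f"
    using nn_integral_real_affine[OF m, of "-1" "c"] by (simp only:) simp
  also have "integral\<^sup>N lborel ?f + integral\<^sup>N lborel ?f = ennreal (2 / (1 - s))"
    using assms(1) unfolding nn_integral_powr_unit_interval[OF assms(1)]
    by (simp flip: ennreal_plus)
  finally show ?thesis .
qed

text \<open>For negative \<open>b\<close>, moving both bases to the smaller of \<open>x\<close> and
  \<open>u\<close> only increases the product, and the exponents combine to \<open>b - a\<close>.
  For nonnegative \<open>b\<close> the first factor is at most 1. Two merging singularities thus
  cost no more than a sum of separate ones.\<close>

lemma powr_mult_powr_le_add:
  fixes x u :: real
  assumes "0 < x" "x \<le> 1" "0 < u" "u \<le> 1" "0 \<le> a" "a \<le> s" "a - b \<le> s"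
  shows "x powr b * u powr - a \<le> x powr - s + u powr - s"
proof (cases "b \<ge> 0")
  case True
  have "x powr b \<le> 1" using True assms by (intro powr_le1) auto
  moreover have "u powr - a \<le> u powr - s" using assms by (intro powr_mono') auto
  ultimately have "x powr b * u powr - a \<le> 1 * u powr - s" by (intro mult_mono) auto
  then show ?thesis by (smt (verit) powr_ge_zero)
next
  case False
  show ?thesis
  proof (cases "x \<le> u")
    case True
    have "x powr b * u powr - a \<le> x powr b * x powr - a"
      using True assms by (intro mult_left_mono powr_mono2') auto
    also have "\<dots> = x powr (b - a)" by (simp flip: powr_add)
    also have "\<dots> \<le> x powr - s" using assms by (intro powr_mono') auto
    finally show ?thesis by (smt (verit) powr_ge_zero)
  next
    case ux: False
    have "x powr b * u powr - a \<le> u powr b * u powr - a"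
      using ux False assms by (intro mult_right_mono powr_mono2') auto
    also have "\<dots> = u powr (b - a)" by (simp flip: powr_add)
    also have "\<dots> \<le> u powr - s" using assms by (intro powr_mono') auto
    finally show ?thesis by (smt (verit) powr_ge_zero)
  qed
qed

lemma powr_le_2:
  fixes x :: real
  assumes "1/2 \<le> x" "x \<le> 1" "-1 < b"
  shows "x powr b \<le> 2"
proof (cases "b \<ge> 0")
  case True
  have "x powr b \<le> 1" using True assms by (intro powr_le1) auto
  then show ?thesis by simp
next
  case False
  have "x powr b \<le> (1/2) powr b" using False assms by (intro powr_mono2') auto
  also have "\<dots> \<le> (1/2) powr (-1)" using assms by (intro powr_mono') auto
  also have "\<dots> = (2::real)" by (simp add: powr_minus_divide)
  finally show ?thesis .
qed

section \<open>The one-variable Jacobi weight against a moving singularity\<close>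

definition beta_weight :: "real \<Rightarrow> real \<Rightarrow> real \<Rightarrow> real" where
  "beta_weight a b x = indicator {0<..<1} x * (x powr a * (1 - x) powr b)"

lemma beta_weight_nonneg [simp]: "0 \<le> beta_weight a b x"
  by (simp add: beta_weight_def)

lemma borel_measurable_beta_weight [measurable]: "beta_weight a b \<in> borel_measurable borel"
  unfolding beta_weight_def by measurable

text \<open>On each half of the interval the factor of the far endpoint is at most 2, so the
  singularity at \<open>y\<close> has to be merged with one endpoint only.\<close>

lemma beta_weight_mult_powr_le:
  fixes x y :: real
  assumes "-1 < a1" "-1 < a2" "0 \<le> y" "y \<le> 1" "0 \<le> a" "a \<le> s" "a - a1 \<le> s" "a - a2 \<le> s"
  shows "beta_weight a1 a2 x * \<bar>x - y\<bar> powr - a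
    \<le> 2 * (\<bar>x - 0\<bar> powr - s + \<bar>x - 1\<bar> powr - s + \<bar>x - y\<bar> powr - s) * indicator {0<..<1} x"
proof (cases "x \<in> {0<..<1} \<and> x \<noteq> y")
  \<comment> \<open>At \<open>x = y\<close> the left-hand side is 0, because
    \<open>0 powr - a = 0\<close> whatever the exponent.\<close>
  case False
  then show ?thesis by (auto simp: beta_weight_def)
next
  case True
  then have x: "0 < x" "x < 1" "0 < \<bar>x - y\<bar>" "\<bar>x - y\<bar> \<le> 1" using assms by auto
  have "x powr a1 * (1 - x) powr a2 * \<bar>x - y\<bar> powr - a
    \<le> 2 * (x powr - s + (1 - x) powr - s + \<bar>x - y\<bar> powr - s)"
  proof (cases "x \<le> 1/2")
    case True
    have "(1 - x) powr a2 * (x powr a1 * \<bar>x - y\<bar> powr - a) \<le> 2 * (x powr - s + \<bar>x - y\<bar> powr - s)"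
      using x True assms by (intro mult_mono powr_le_2 powr_mult_powr_le_add) auto
    also have "\<dots> \<le> 2 * (x powr - s + (1 - x) powr - s + \<bar>x - y\<bar> powr - s)" by simp
    finally show ?thesis by (simp only: mult_ac)
  next
    case False
    have "x powr a1 * ((1 - x) powr a2 * \<bar>x - y\<bar> powr - a)
        \<le> 2 * ((1 - x) powr - s + \<bar>x - y\<bar> powr - s)"
      using x False assms by (intro mult_mono powr_le_2 powr_mult_powr_le_add) auto
    also have "\<dots> \<le> 2 * (x powr - s + (1 - x) powr - s + \<bar>x - y\<bar> powr - s)" by simp
    finally show ?thesis by (simp only: mult_ac)
  qed
  then show ?thesis using x by (simp add: beta_weight_def)
qed

text \<open>The constant 12 is the factor 2 of the pointwise bound times \<open>2 / (1 - s)\<close>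
  for each of the three singular points \<open>0\<close>, \<open>1\<close> and \<open>y\<close>. It
  does not depend on \<open>y\<close>.\<close>

lemma nn_integral_beta_weight_powr_le:
  fixes y :: real
  assumes "-1 < a1" "-1 < a2" "0 \<le> y" "y \<le> 1" "0 \<le> a" "a \<le> s" "a - a1 \<le> s" "a - a2 \<le> s" "s < 1"
  shows "(\<integral>\<^sup>+x. ennreal (beta_weight a1 a2 x * \<bar>x - y\<bar> powr - a) \<partial>lborel) \<le> ennreal (12 / (1 - s))"
proof -
  let ?g = "\<lambda>c x. ennreal (\<bar>x - c\<bar> powr - s) * indicator {0<..<1::real} x"
  have "(\<integral>\<^sup>+x. ennreal (beta_weight a1 a2 x * \<bar>x - y\<bar> powr - a) \<partial>lborel)
      \<le> (\<integral>\<^sup>+x. 2 * (?g 0 x + ?g 1 x + ?g y x) \<partial>lborel)"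
  proof (rule nn_integral_mono)
    fix x :: real
    have "ennreal (beta_weight a1 a2 x * \<bar>x - y\<bar> powr - a)
      \<le> ennreal (2 * (\<bar>x - 0\<bar> powr - s + \<bar>x - 1\<bar> powr - s + \<bar>x - y\<bar> powr - s) * indicator {0<..<1} x)"
      using assms by (intro ennreal_leI beta_weight_mult_powr_le) auto
    also have "\<dots> = 2 * (?g 0 x + ?g 1 x + ?g y x)"
      by (auto simp: indicator_def ennreal_mult simp del: distrib_left_numeral)
    finally show "ennreal (beta_weight a1 a2 x * \<bar>x - y\<bar> powr - a) \<le> 2 * (?g 0 x + ?g 1 x + ?g y x)" .
  qed
  also have "\<dots> = 2 * (integral\<^sup>N lborel (?g 0) + integral\<^sup>N lborel (?g 1) + integral\<^sup>N lborel (?g y))"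
    by (subst nn_integral_cmult, measurable, subst nn_integral_add, measurable, subst nn_integral_add) auto
  also have "\<dots> \<le> 2 * (ennreal (2 / (1 - s)) + ennreal (2 / (1 - s)) + ennreal (2 / (1 - s)))"
    using assms by (intro mult_left_mono add_mono nn_integral_abs_powr_le) auto
  also have "\<dots> = ennreal (2 * (2 / (1 - s) + 2 / (1 - s) + 2 / (1 - s)))"
    using assms by (subst ennreal_mult') (auto simp flip: ennreal_plus)
  finally show ?thesis by simp
qed

lemma nn_integral_beta_weight_finite:
  assumes "-1 < a1" "-1 < a2"
  shows "(\<integral>\<^sup>+x. ennreal (beta_weight a1 a2 x) \<partial>lborel) < \<infinity>"
proof -
  have "(\<integral>\<^sup>+x. ennreal (beta_weight a1 a2 x) \<partial>lborel)
      = (\<integral>\<^sup>+x. ennreal (beta_weight a1 a2 x * \<bar>x - 0\<bar> powr - 0) \<partial>lborel)"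
    by (intro nn_integral_cong) (auto simp: beta_weight_def indicator_def)
  \<comment> \<open>Instance \<open>a = 0\<close>, \<open>y = 0\<close>, for which the maximum is
    the smallest admissible \<open>s\<close>; it is below 1.\<close>
  also have "\<dots> \<le> ennreal (12 / (1 - Max {0, - a1, - a2}))"
    using assms by (intro nn_integral_beta_weight_powr_le) auto
  finally show ?thesis by (simp add: le_less_trans)
qed

interpretation lborel_prod: product_sigma_finite "\<lambda>_::nat. lborel :: real measure"
  by standard

text \<open>Once the centre coordinate is fixed at \<open>y\<close>, the other coordinates decouple
  and each contributes a factor bounded uniformly in \<open>y\<close>. Only the integral of the
  one-variable weight is left.\<close>

lemma nn_integral_star_finite:
  fixes a1 a2 a :: real and c N :: nat
  assumes "-1 < a1" "-1 < a2" "0 \<le> a" "a < 1" "a < 1 + a1" "a < 1 + a2" "c < N"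
  shows "(\<integral>\<^sup>+x. ennreal ((\<Prod>l<N. beta_weight a1 a2 (x l)) *
      (\<Prod>k\<in>{..<N}-{c}. \<bar>x k - x c\<bar> powr - a)) \<partial>(\<Pi>\<^sub>M l\<in>{..<N}. lborel)) < \<infinity>"
proof -
  let ?I = "{..<N} - {c}"
  let ?b = "beta_weight a1 a2"
  \<comment> \<open>The worst exponent reached by a singularity of order \<open>a\<close> in the
    interior or on meeting either endpoint. The three upper bounds on \<open>a\<close> say exactly
    that \<open>s < 1\<close>.\<close>
  define s where "s = Max {a, a - a1, a - a2}"
  have s: "a \<le> s" "a - a1 \<le> s" "a - a2 \<le> s" "s < 1" using assms by (auto simp: s_def)
  let ?f = "\<lambda>x. ennreal ((\<Prod>l<N. ?b (x l)) * (\<Prod>k\<in>?I. \<bar>x k - x c\<bar> powr - a))"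
  have N: "{..<N} = insert c ?I" using assms(7) by auto
  have m: "?f \<in> borel_measurable (\<Pi>\<^sub>M l\<in>insert c ?I. lborel)"
    unfolding N[symmetric] by measurable (use assms(7) in auto)
  have "(\<integral>\<^sup>+x. ?f x \<partial>(\<Pi>\<^sub>M l\<in>insert c ?I. lborel))
      = (\<integral>\<^sup>+y. (\<integral>\<^sup>+x. ?f (x(c := y)) \<partial>(\<Pi>\<^sub>M l\<in>?I. lborel)) \<partial>lborel)"
    by (rule lborel_prod.product_nn_integral_insert_rev[OF _ _ m]) auto
  also have "\<dots> = (\<integral>\<^sup>+y. ennreal (?b y) *
      (\<integral>\<^sup>+x. (\<Prod>k\<in>?I. ennreal (?b (x k) * \<bar>x k - y\<bar> powr - a)) \<partial>(\<Pi>\<^sub>M l\<in>?I. lborel)) \<partial>lborel)"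
  proof (intro nn_integral_cong)
    fix y
    have "?f (x(c := y)) = ennreal (?b y) * (\<Prod>k\<in>?I. ennreal (?b (x k) * \<bar>x k - y\<bar> powr - a))" for x
    proof -
      have "(\<Prod>l<N. ?b ((x(c := y)) l)) = ?b y * (\<Prod>k\<in>?I. ?b (x k))"
        by (subst N, subst prod.insert) (auto intro!: prod.cong)
      moreover have "(\<Prod>k\<in>?I. \<bar>(x(c := y)) k - (x(c := y)) c\<bar> powr - a) = (\<Prod>k\<in>?I. \<bar>x k - y\<bar> powr - a)"
        by (intro prod.cong) auto
      ultimately show ?thesis
        by (simp add: prod_ennreal prod.distrib mult.assoc ennreal_mult' prod_nonneg)
    qed
    then show "(\<integral>\<^sup>+x. ?f (x(c := y)) \<partial>(\<Pi>\<^sub>M l\<in>?I. lborel)) = ennreal (?b y) *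
      (\<integral>\<^sup>+x. (\<Prod>k\<in>?I. ennreal (?b (x k) * \<bar>x k - y\<bar> powr - a)) \<partial>(\<Pi>\<^sub>M l\<in>?I. lborel))"
      by (simp only:) (rule nn_integral_cmult, measurable)
  qed
  also have "\<dots> = (\<integral>\<^sup>+y. ennreal (?b y) *
      (\<Prod>k\<in>?I. \<integral>\<^sup>+x. ennreal (?b x * \<bar>x - y\<bar> powr - a) \<partial>lborel) \<partial>lborel)"
    by (subst lborel_prod.product_nn_integral_prod) auto
  also have "\<dots> \<le> (\<integral>\<^sup>+y. ennreal (?b y) * (\<Prod>k\<in>?I. ennreal (12 / (1 - s))) \<partial>lborel)"
  proof (intro nn_integral_mono)
    fix y :: real
    show "ennreal (?b y) * (\<Prod>k\<in>?I. \<integral>\<^sup>+x. ennreal (?b x * \<bar>x - y\<bar> powr - a) \<partial>lborel)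
      \<le> ennreal (?b y) * (\<Prod>k\<in>?I. ennreal (12 / (1 - s)))"
    \<comment> \<open>The uniform bound needs \<open>y\<close> in the unit interval; outside it
      \<open>?b y\<close> is 0.\<close>
    proof (cases "y \<in> {0<..<1}")
      case True
      then have "(\<integral>\<^sup>+x. ennreal (?b x * \<bar>x - y\<bar> powr - a) \<partial>lborel) \<le> ennreal (12 / (1 - s))"
        using assms s by (intro nn_integral_beta_weight_powr_le) auto
      then show ?thesis by (intro mult_left_mono prod_mono_ennreal) auto
    qed (simp add: beta_weight_def)
  qed
  also have "\<dots> = (\<integral>\<^sup>+y. ennreal (?b y) \<partial>lborel) * (\<Prod>k\<in>?I. ennreal (12 / (1 - s)))"
    by (rule nn_integral_multc) measurable
  also have "\<dots> < \<infinity>"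
    using nn_integral_beta_weight_finite[OF assms(1,2)]
    by (auto simp: ennreal_mult_less_top power_less_top_ennreal)
  finally show ?thesis unfolding N[symmetric] .
qed

section \<open>Bounding the pair product by star products\<close>

text \<open>Each unordered pair occurs twice on the left, once for each of its members as the centre
  \<open>c\<close>.\<close>

lemma prod_pairs_symmetric:
  fixes f :: "nat \<Rightarrow> nat \<Rightarrow> 'a::comm_monoid_mult"
  assumes "\<And>j k. f j k = f k j"
  shows "(\<Prod>c<N. \<Prod>k\<in>{..<N}-{c}. f k c) = (\<Prod>k<N. \<Prod>j<k. f k j) * (\<Prod>k<N. \<Prod>j<k. f k j)"
proof (induction N)
  case (Suc N)
  have *: "(\<Prod>k\<in>{..<Suc N}-{c}. f k c) = (\<Prod>k\<in>{..<N}-{c}. f k c) * f N c" if "c < N" for c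
  proof -
    have "{..<Suc N}-{c} = insert N ({..<N}-{c})" using that by auto
    then show ?thesis by (simp add: mult.commute)
  qed
  have **: "{..<Suc N}-{N} = {..<N}" by auto
  have "(\<Prod>c<Suc N. \<Prod>k\<in>{..<Suc N}-{c}. f k c)
      = (\<Prod>c<N. (\<Prod>k\<in>{..<N}-{c}. f k c) * f N c) * (\<Prod>k<N. f N k)"
    using assms[of N] * by (simp add: ** cong: prod.cong_simp)
  then show ?case by (simp add: prod.distrib Suc.IH mult_ac)
qed simp

text \<open>The left-hand side is the geometric mean over \<open>c\<close> of the star products on the right.\<close>

lemma pair_prod_powr_le_sum_stars:
  fixes x :: "nat \<Rightarrow> real"
  assumes "0 < N" "0 \<le> a"
  shows "(\<Prod>k<N. \<Prod>j<k. \<bar>x k - x j\<bar> powr (- 2 * a / real N))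
     \<le> (\<Sum>c<N. \<Prod>k\<in>{..<N}-{c}. \<bar>x k - x c\<bar> powr - a)" (is "?P \<le> (\<Sum>c<N. ?S c)")
proof (rule ccontr)
  assume neg: "\<not> ?P \<le> (\<Sum>c<N. ?S c)"
  have lt: "?S c < ?P" if "c < N" for c
  proof -
    have "?S c \<le> (\<Sum>c<N. ?S c)" using that by (intro member_le_sum) (auto intro: prod_nonneg)
    then show ?thesis using neg by linarith
  qed
  \<comment> \<open>Multiplying all stars counts every pair twice with exponent \<open>- a\<close>,
    which is exactly \<open>?P ^ N\<close>; hence the stars cannot all lie strictly below
    \<open>?P\<close>.\<close>
  have "(\<Prod>c<N. ?S c) < (\<Prod>c<N. ?P)"
  proof (rule prod_mono_strict[of 0])
    show "0 < ?P" using lt[OF assms(1)] by (rule le_less_trans[rotated]) (auto intro: prod_nonneg)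
  qed (use lt assms in \<open>auto intro: prod_nonneg less_imp_le\<close>)
  also have "(\<Prod>c<N. ?P) = ?P ^ N" by simp
  also have "?P ^ N = (\<Prod>k<N. \<Prod>j<k. (\<bar>x k - x j\<bar> powr (- 2 * a / real N)) ^ N)"
    by (simp add: prod_power_distrib)
  also have "\<dots> = (\<Prod>k<N. \<Prod>j<k. \<bar>x k - x j\<bar> powr - a * \<bar>x k - x j\<bar> powr - a)"
  proof (intro prod.cong refl)
    fix k j
    have "(\<bar>x k - x j\<bar> powr (- 2 * a / real N)) ^ N = \<bar>x k - x j\<bar> powr (- 2 * a / real N * real N)"
      using assms(1) by (cases "x k = x j") (auto simp: powr_power)
    also have "- 2 * a / real N * real N = - a + - a" using assms(1) by simp
    finally show "(\<bar>x k - x j\<bar> powr (- 2 * a / real N)) ^ N = \<bar>x k - x j\<bar> powr - a * \<bar>x k - x j\<bar> powr - a"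
      by (simp only: powr_add)
  qed
  also have "\<dots> = (\<Prod>c<N. ?S c)"
    by (subst prod_pairs_symmetric) (auto simp: abs_minus_commute prod.distrib)
  finally show False by simp
qed

section \<open>The Jacobi ensemble as a probability measure\<close>

locale jacobi_parameters =
  fixes \<alpha> \<alpha>\<^sub>1 \<alpha>\<^sub>2 :: real and N :: nat
  assumes \<alpha>\<^sub>1: "-1 < \<alpha>\<^sub>1" and \<alpha>\<^sub>2: "-1 < \<alpha>\<^sub>2"
    and \<alpha>: "- 1 < \<alpha>" "- (1 + \<alpha>\<^sub>1) < \<alpha>" "- (1 + \<alpha>\<^sub>2) < \<alpha>"
    and N_pos: "0 < N"
begin

abbreviation L :: "(nat \<Rightarrow> real) measure" where
  "L \<equiv> \<Pi>\<^sub>M l\<in>{..<N}. lborel"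

abbreviation cube :: "(nat \<Rightarrow> real) set" where
  "cube \<equiv> \<Pi>\<^sub>E l\<in>{..<N}. {0<..<1}"

abbreviation w :: "(nat \<Rightarrow> real) \<Rightarrow> real" where
  "w \<equiv> jacobi_weight \<alpha>\<^sub>1 \<alpha>\<^sub>2 (2 * \<alpha> / real N) N"

abbreviation Z :: real where
  "Z \<equiv> LINT y|L. w y"

abbreviation J :: "(nat \<Rightarrow> real) measure" where
  "J \<equiv> jacobi_ensemble \<alpha>\<^sub>1 \<alpha>\<^sub>2 (2 * \<alpha> / real N) N"

lemma cubeD: "x \<in> cube \<Longrightarrow> l < N \<Longrightarrow> 0 < x l \<and> x l < 1"
  by (auto simp: PiE_iff)

lemma sets_cube [measurable]: "cube \<in> sets L"
  by measurable

lemma w_eq_on_cube: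
  "x \<in> cube \<Longrightarrow> w x = (\<Prod>l<N. x l powr \<alpha>\<^sub>1 * (1 - x l) powr \<alpha>\<^sub>2) *
     (\<Prod>k<N. \<Prod>j<k. \<bar>x k - x j\<bar> powr (2 * \<alpha> / real N))"
  by (simp add: jacobi_weight_def)

lemma w_outside: "x \<notin> cube \<Longrightarrow> w x = 0"
  by (simp add: jacobi_weight_def)

lemma w_nonneg [simp]: "0 \<le> w x"
  by (auto simp: jacobi_weight_def intro!: mult_nonneg_nonneg prod_nonneg)

lemma borel_measurable_w [measurable]: "w \<in> borel_measurable L"
proof -
  have [measurable]: "(\<lambda>x. \<Prod>k<N. \<Prod>j<k. \<bar>x k - x j\<bar> powr (2 * \<alpha> / real N)) \<in> borel_measurable L"
  proof (intro borel_measurable_prod)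
    fix k j assume "k \<in> {..<N}" "j \<in> {..<k}"
    then have [measurable]: "(\<lambda>x. x k) \<in> borel_measurable L" "(\<lambda>x. x j) \<in> borel_measurable L"
      by (auto intro!: measurable_component_singleton)
    show "(\<lambda>x. \<bar>x k - x j\<bar> powr (2 * \<alpha> / real N)) \<in> borel_measurable L" by measurable
  qed
  show ?thesis unfolding jacobi_weight_def by measurable
qed

lemma w_eq_beta_weight:
  assumes "x \<in> cube"
  shows "w x = (\<Prod>l<N. beta_weight \<alpha>\<^sub>1 \<alpha>\<^sub>2 (x l)) *
     (\<Prod>k<N. \<Prod>j<k. \<bar>x k - x j\<bar> powr (2 * \<alpha> / real N))"
  using cubeD[OF assms] by (simp add: w_eq_on_cube[OF assms] beta_weight_def)

text \<open>For \<open>\<alpha> \<ge> 0\<close> the pair product is at most 1 on the cube and the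
  bound factorises into Beta integrals. For \<open>\<alpha> < 0\<close> the star bound applies with
  \<open>a = - \<alpha>\<close>, whose conditions are the parameter assumptions.\<close>

lemma nn_integral_w_finite: "(\<integral>\<^sup>+x. ennreal (w x) \<partial>L) < \<infinity>"
proof (cases "\<alpha> \<ge> 0")
  case True
  have "(\<integral>\<^sup>+x. ennreal (w x) \<partial>L) \<le> (\<integral>\<^sup>+x. (\<Prod>l<N. ennreal (beta_weight \<alpha>\<^sub>1 \<alpha>\<^sub>2 (x l))) \<partial>L)"
  proof (intro nn_integral_mono)
    fix x
    show "ennreal (w x) \<le> (\<Prod>l<N. ennreal (beta_weight \<alpha>\<^sub>1 \<alpha>\<^sub>2 (x l)))"
    proof (cases "x \<in> cube")
      case x: True
      have "\<bar>x k - x j\<bar> powr (2 * \<alpha> / real N) \<le> 1" if "k < N" "j < k" for j k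
        using cubeD[OF x, of k] cubeD[OF x, of j] that True by (intro powr_le1) auto
      then have "(\<Prod>k<N. \<Prod>j<k. \<bar>x k - x j\<bar> powr (2 * \<alpha> / real N)) \<le> 1"
        by (intro prod_le_1 conjI prod_nonneg) auto
      then have "w x \<le> (\<Prod>l<N. beta_weight \<alpha>\<^sub>1 \<alpha>\<^sub>2 (x l)) * 1"
        unfolding w_eq_beta_weight[OF x] by (intro mult_left_mono) (auto intro: prod_nonneg)
      then show ?thesis by (simp add: prod_ennreal ennreal_leI)
    qed (simp add: w_outside)
  qed
  also have "\<dots> = (\<Prod>l<N. \<integral>\<^sup>+x. ennreal (beta_weight \<alpha>\<^sub>1 \<alpha>\<^sub>2 x) \<partial>lborel)"
    by (rule lborel_prod.product_nn_integral_prod) auto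
  also have "\<dots> < \<infinity>"
    using nn_integral_beta_weight_finite[OF \<alpha>\<^sub>1 \<alpha>\<^sub>2] by (simp add: power_less_top_ennreal)
  finally show ?thesis .
next
  case False
  define a where "a = - \<alpha>"
  have a: "0 \<le> a" "a < 1" "a < 1 + \<alpha>\<^sub>1" "a < 1 + \<alpha>\<^sub>2" using False \<alpha> by (auto simp: a_def)
  let ?f = "\<lambda>c x. ennreal ((\<Prod>l<N. beta_weight \<alpha>\<^sub>1 \<alpha>\<^sub>2 (x l)) * (\<Prod>k\<in>{..<N}-{c}. \<bar>x k - x c\<bar> powr - a))"
  have "(\<integral>\<^sup>+x. ennreal (w x) \<partial>L) \<le> (\<integral>\<^sup>+x. (\<Sum>c<N. ?f c x) \<partial>L)"
  proof (intro nn_integral_mono)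
    fix x
    show "ennreal (w x) \<le> (\<Sum>c<N. ?f c x)"
    proof (cases "x \<in> cube")
      case x: True
      have "w x \<le> (\<Prod>l<N. beta_weight \<alpha>\<^sub>1 \<alpha>\<^sub>2 (x l)) * (\<Sum>c<N. \<Prod>k\<in>{..<N}-{c}. \<bar>x k - x c\<bar> powr - a)"
        unfolding w_eq_beta_weight[OF x]
        using pair_prod_powr_le_sum_stars[OF N_pos a(1), of x]
        by (intro mult_left_mono) (auto intro: prod_nonneg simp: a_def)
      also have "\<dots> = (\<Sum>c<N. (\<Prod>l<N. beta_weight \<alpha>\<^sub>1 \<alpha>\<^sub>2 (x l)) * (\<Prod>k\<in>{..<N}-{c}. \<bar>x k - x c\<bar> powr - a))"
        by (rule sum_distrib_left)
      finally show ?thesis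
        by (subst sum_ennreal) (auto intro!: ennreal_leI mult_nonneg_nonneg prod_nonneg)
    qed (simp add: w_outside)
  qed
  also have "\<dots> = (\<Sum>c<N. \<integral>\<^sup>+x. ?f c x \<partial>L)"
  proof (rule nn_integral_sum)
    show "?f c \<in> borel_measurable L" if "c \<in> {..<N}" for c
      by measurable (use that in auto)
  qed
  also have "\<dots> < \<infinity>"
    using nn_integral_star_finite[OF \<alpha>\<^sub>1 \<alpha>\<^sub>2 a] by simp
  finally show ?thesis .
qed

lemma integrable_w: "integrable L w"
  using nn_integral_w_finite by (intro integrableI_nonneg) auto

section \<open>Positivity of the partition function, and expectations\<close>

text \<open>A vanishing partition function would make the weight vanish almost everywhere, yet it is
  positive on a box of positive volume.\<close>

lemma Z_pos: "0 < Z"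
proof (rule ccontr)
  assume "\<not> 0 < Z"
  moreover have "0 \<le> Z" by (rule Bochner_Integration.integral_nonneg) simp
  ultimately have "Z = 0" by linarith
  then have ae: "AE x in L. w x = 0"
    using integrable_w by (subst (asm) integral_nonneg_eq_0_iff_AE) auto
  \<comment> \<open>Disjoint consecutive intervals keep the coordinates pairwise distinct, so that
    no pair factor is 0.\<close>
  define B where "B = (\<Pi>\<^sub>E l\<in>{..<N}. {real l / real (Suc N)<..<real (Suc l) / real (Suc N)})"
  have w_pos: "w x > 0" if "x \<in> B" for x
  proof -
    have x: "real l / real (Suc N) < x l" "x l < real (Suc l) / real (Suc N)" if "l < N" for l
      using \<open>x \<in> B\<close> that by (auto simp: B_def PiE_iff)
    have pos: "0 < x l" "x l < 1" if "l < N" for l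
    proof -
      show "0 < x l" using x(1)[OF that] by (rule le_less_trans[rotated]) simp
      have "real (Suc l) / real (Suc N) \<le> 1" using that by simp
      then show "x l < 1" using x(2)[OF that] by linarith
    qed
    have cube: "x \<in> cube" using pos \<open>x \<in> B\<close> by (auto simp: PiE_iff B_def)
    have "x j < x k" if "k < N" "j < k" for j k
    proof -
      have "x j < real (Suc j) / real (Suc N)" using x that by simp
      also have "\<dots> \<le> real k / real (Suc N)" using that by (intro divide_right_mono) auto
      also have "\<dots> < x k" using x that by simp
      finally show ?thesis .
    qed
    then have "x k \<noteq> x j" if "k < N" "j < k" for j k using that by fastforce
    then show ?thesis unfolding w_eq_on_cube[OF cube]
    proof (intro mult_pos_pos prod_pos)
      fix l assume "l \<in> {..<N}"
      then show "0 < x l powr \<alpha>\<^sub>1" "0 < (1 - x l) powr \<alpha>\<^sub>2" using pos[of l] by auto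
    next
      fix k j assume "k \<in> {..<N}" "j \<in> {..<k}"
      then show "0 < \<bar>x k - x j\<bar> powr (2 * \<alpha> / real N)"
        using \<open>\<And>j k. k < N \<Longrightarrow> j < k \<Longrightarrow> x k \<noteq> x j\<close>[of k j] by simp
    qed
  qed
  have "AE x in L. x \<notin> B" using ae
  proof eventually_elim
    case (elim x)
    then show ?case using w_pos[of x] by auto
  qed
  moreover have B: "B \<in> sets L" unfolding B_def by measurable
  moreover have "{x \<in> space L. x \<in> B} = B" using sets.sets_into_space[OF B] by blast
  ultimately have "emeasure L B = 0" by (subst (asm) AE_iff_measurable[OF _ refl]) simp_all
  moreover have "emeasure L B = (\<Prod>l<N. emeasure lborel {real l / real (Suc N)<..<real (Suc l) / real (Suc N)})"
    unfolding B_def by (rule lborel_prod.emeasure_PiM) auto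
  moreover have "emeasure lborel {real l / real (Suc N)<..<real (Suc l) / real (Suc N)} = ennreal (1 / real (Suc N))" for l
    by (subst emeasure_lborel_Ioo) (auto simp: divide_right_mono simp flip: diff_divide_distrib)
  ultimately show False by simp
qed

lemma jacobi_ensemble_eq: "J = density L (\<lambda>x. ennreal (w x / Z))"
  by (simp add: jacobi_ensemble_def Let_def)

sublocale J: prob_space J
proof
  have "emeasure J (space J) = (\<integral>\<^sup>+x. ennreal (w x / Z) \<partial>L)"
    unfolding jacobi_ensemble_eq by (subst emeasure_density) (auto intro!: nn_integral_cong)
  also have "\<dots> = ennreal (LINT x|L. w x / Z)"
    using integrable_w Z_pos by (intro nn_integral_eq_integral) (auto intro!: divide_nonneg_pos)
  also have "\<dots> = 1" using Z_pos by simp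
  finally show "emeasure J (space J) = 1" .
qed

lemma integral_J:
  fixes f :: "(nat \<Rightarrow> real) \<Rightarrow> real"
  assumes "f \<in> borel_measurable L"
  shows "(LINT x|J. f x) = (LINT x|L. w x * f x) / Z"
proof -
  have "(LINT x|J. f x) = (LINT x|L. (w x / Z) *\<^sub>R f x)"
    unfolding jacobi_ensemble_eq
  proof (rule integral_density)
    show "AE x in L. 0 \<le> w x / Z" using Z_pos by (intro AE_I2 divide_nonneg_pos) auto
  qed (use assms in measurable)
  then show ?thesis by simp
qed

lemma AE_J_cube: "AE x in J. x \<in> cube"
  unfolding jacobi_ensemble_eq
proof (subst AE_density)
  have "0 < ennreal (w x / Z) \<longrightarrow> x \<in> cube" for x
    using w_outside[of x] by (cases "x \<in> cube") simp_all
  then show "AE x in L. 0 < ennreal (w x / Z) \<longrightarrow> x \<in> cube" by (intro AE_I2)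
  show "(\<lambda>x. ennreal (w x / Z)) \<in> borel_measurable L" by measurable
qed

lemma integrable_J_bounded:
  fixes f :: "(nat \<Rightarrow> real) \<Rightarrow> real"
  assumes "f \<in> borel_measurable L" "\<And>x. x \<in> cube \<Longrightarrow> \<bar>f x\<bar> \<le> C"
  shows "integrable J f"
proof (rule J.integrable_const_bound[where B=C])
  show "AE x in J. norm (f x) \<le> C"
    using AE_J_cube assms(2) by (auto elim: eventually_mono)
  show "f \<in> borel_measurable J"
    using assms(1) by (simp add: jacobi_ensemble_eq)
qed

end

section \<open>Substitution in all coordinates of the unit cube\<close>

text \<open>Both measures agree on boxes, where the integral is a product of one-dimensional ones. A
  coordinatewise change of variables is thereby reduced to dimension one.\<close>

lemma distr_PiM_density:
  fixes g :: "real \<Rightarrow> ennreal" and \<phi> :: "real \<Rightarrow> real" and I :: "nat set"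
  assumes [simp]: "finite I" and g [measurable]: "g \<in> borel_measurable borel"
    and \<phi> [measurable]: "\<phi> \<in> borel_measurable borel"
    and \<nu>: "distr (density lborel g) borel \<phi> = \<nu>" and "sigma_finite_measure \<nu>"
  shows "distr (density (\<Pi>\<^sub>M l\<in>I. lborel) (\<lambda>x. \<Prod>l\<in>I. g (x l))) (\<Pi>\<^sub>M l\<in>I. lborel)
     (\<lambda>x. \<lambda>l\<in>I. \<phi> (x l)) = (\<Pi>\<^sub>M l\<in>I. \<nu>)" (is "distr ?D ?L ?\<phi> = _")
proof -
  interpret \<nu>: product_sigma_finite "\<lambda>_::nat. \<nu>"
    using assms(5) by (simp add: product_sigma_finite_def)
  have sets_\<nu>: "sets \<nu> = sets borel" by (simp flip: \<nu>)
  show ?thesis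
  proof (rule \<nu>.PiM_eqI)
    show "sets (distr ?D ?L ?\<phi>) = sets (\<Pi>\<^sub>M l\<in>I. \<nu>)"
      by (auto simp: sets_\<nu> intro!: sets_PiM_cong)
  next
    fix A :: "nat \<Rightarrow> real set" assume "\<And>i. i \<in> I \<Longrightarrow> A i \<in> sets \<nu>"
    then have A [measurable]: "\<And>i. i \<in> I \<Longrightarrow> A i \<in> sets borel" by (simp add: sets_\<nu>)
    have [measurable]: "?\<phi> \<in> measurable ?L ?L" by measurable
    have PA: "Pi\<^sub>E I A \<in> sets ?L" using A by (intro sets_PiM_I_finite) auto
    have "emeasure (distr ?D ?L ?\<phi>) (Pi\<^sub>E I A) = emeasure ?D (?\<phi> -` Pi\<^sub>E I A \<inter> space ?L)"
      using PA by (subst emeasure_distr) auto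
    also have "\<dots> = (\<integral>\<^sup>+x. (\<Prod>l\<in>I. g (x l)) * indicator (?\<phi> -` Pi\<^sub>E I A \<inter> space ?L) x \<partial>?L)"
      using PA by (intro emeasure_density) auto
    also have "\<dots> = (\<integral>\<^sup>+x. (\<Prod>l\<in>I. g (x l) * indicator (A l) (\<phi> (x l))) \<partial>?L)"
    proof (intro nn_integral_cong)
      fix x assume "x \<in> space ?L"
      then have "indicator (?\<phi> -` Pi\<^sub>E I A \<inter> space ?L) x = (\<Prod>l\<in>I. indicator (A l) (\<phi> (x l)) :: ennreal)"
        by (auto simp: indicator_def PiE_iff prod_zero_iff)
      then show "(\<Prod>l\<in>I. g (x l)) * indicator (?\<phi> -` Pi\<^sub>E I A \<inter> space ?L) x
          = (\<Prod>l\<in>I. g (x l) * indicator (A l) (\<phi> (x l)))"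
        by (simp add: prod.distrib)
    qed
    also have "\<dots> = (\<Prod>l\<in>I. \<integral>\<^sup>+x. g x * indicator (A l) (\<phi> x) \<partial>lborel)"
      using A by (intro lborel_prod.product_nn_integral_prod) auto
    also have "\<dots> = (\<Prod>l\<in>I. emeasure \<nu> (A l))"
    proof (intro prod.cong refl)
      fix l assume "l \<in> I"
      note [measurable] = A[OF this]
      have "emeasure \<nu> (A l) = emeasure (density lborel g) (\<phi> -` A l)"
        by (subst \<nu>[symmetric], subst emeasure_distr) auto
      also have "\<dots> = (\<integral>\<^sup>+x. g x * indicator (\<phi> -` A l) x \<partial>lborel)"
        using measurable_sets[OF \<phi> A[OF \<open>l \<in> I\<close>]] by (intro emeasure_density) auto
      finally show "(\<integral>\<^sup>+x. g x * indicator (A l) (\<phi> x) \<partial>lborel) = emeasure \<nu> (A l)"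
        by (simp add: indicator_def)
    qed
    finally show "emeasure (distr ?D ?L ?\<phi>) (Pi\<^sub>E I A) = (\<Prod>l\<in>I. emeasure \<nu> (A l))" .
  qed simp
qed

text \<open>The map acts on each coordinate separately, so the Jacobian is the product of the
  derivatives and the one-dimensional substitution rule suffices.\<close>

lemma nn_integral_unit_cube_substitution:
  fixes \<phi> \<phi>' :: "real \<Rightarrow> real" and I :: "nat set"
  assumes "finite I"
    and deriv: "\<And>x. x \<in> {0..1} \<Longrightarrow> (\<phi> has_real_derivative \<phi>' x) (at x)"
    and cont: "continuous_on {0..1} \<phi>'" and nonneg: "\<And>x. x \<in> {0..1} \<Longrightarrow> 0 \<le> \<phi>' x"
    and \<phi>: "\<phi> 0 = 0" "\<phi> 1 = 1" "\<And>x. x \<in> {0<..<1} \<Longrightarrow> \<phi> x \<in> {0<..<1}"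
    and [measurable]: "\<phi> \<in> borel_measurable borel" "\<phi>' \<in> borel_measurable borel"
    and F [measurable]: "F \<in> borel_measurable (\<Pi>\<^sub>M l\<in>I. lborel)"
  shows "(\<integral>\<^sup>+x. F x * (\<Prod>l\<in>I. indicator {0<..<1} (x l)) \<partial>(\<Pi>\<^sub>M l\<in>I. lborel)) =
    (\<integral>\<^sup>+x. F (\<lambda>l\<in>I. \<phi> (x l)) * (\<Prod>l\<in>I. ennreal (\<phi>' (x l)) * indicator {0<..<1} (x l)) \<partial>(\<Pi>\<^sub>M l\<in>I. lborel))"
proof -
  let ?L = "\<Pi>\<^sub>M l\<in>I. (lborel :: real measure)"
  let ?g = "\<lambda>x. ennreal (\<phi>' x) * indicator {0<..<1} x"
  let ?h = "indicator {0<..<1} :: real \<Rightarrow> ennreal"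
  let ?\<nu> = "density lborel ?h"
  \<comment> \<open>In dimension one, \<open>\<phi>\<close> carries the density
    \<open>\<phi>'\<close> on the open interval to the uniform distribution.\<close>
  have 1: "distr (density lborel ?g) borel \<phi> = ?\<nu>"
  proof (rule measure_eqI)
    fix A assume "A \<in> sets (distr (density lborel ?g) borel \<phi>)"
    then have [measurable]: "A \<in> sets borel" by simp
    let ?f = "indicator (A \<inter> {0<..<1}) :: real \<Rightarrow> real"
    have "emeasure ?\<nu> A = (\<integral>\<^sup>+x. ennreal (?f x) * indicator {\<phi> 0..\<phi> 1} x \<partial>lborel)"
      by (subst emeasure_density) (auto simp: \<phi> indicator_def intro!: nn_integral_cong)
    also have "\<dots> = (\<integral>\<^sup>+x. ennreal (?f x * indicator {\<phi> 0..\<phi> 1} x) \<partial>lborel)"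
      by (intro nn_integral_cong) (auto simp: indicator_def)
    also have "\<dots> = (\<integral>\<^sup>+x. ennreal (?f (\<phi> x) * \<phi>' x * indicator {0..1} x) \<partial>lborel)"
      using deriv cont nonneg
      by (intro nn_integral_substitution) (auto simp: set_borel_measurable_def)
    also have "\<dots> = (\<integral>\<^sup>+x. ?g x * indicator (\<phi> -` A \<inter> space lborel) x \<partial>lborel)"
    proof (intro nn_integral_cong)
      fix x :: real
      \<comment> \<open>The substitution rule works on the closed interval. At the endpoints both
        sides are 0, since \<open>\<phi>\<close> fixes them and the indicators belong to the open
        interval.\<close>
      consider "x \<in> {0<..<1}" | "x = 0" | "x = 1" | "x \<notin> {0..1}" by fastforce
      then show "ennreal (?f (\<phi> x) * \<phi>' x * indicator {0..1} x) = ?g x * indicator (\<phi> -` A \<inter> space lborel) x"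
      proof cases
        case 1
        then show ?thesis using \<phi>(3)[OF 1] by (auto simp: indicator_def)
      qed (auto simp: \<phi>)
    qed
    also have "\<dots> = emeasure (distr (density lborel ?g) borel \<phi>) A"
    proof (subst emeasure_distr)
      have "\<phi> -` A \<inter> space lborel \<in> sets lborel"
        using measurable_sets[of \<phi> borel borel A] by simp
      then show "(\<integral>\<^sup>+x. ?g x * indicator (\<phi> -` A \<inter> space lborel) x \<partial>lborel)
          = emeasure (density lborel ?g) (\<phi> -` A \<inter> space (density lborel ?g))"
        by (subst emeasure_density) auto
    qed auto
    finally show "emeasure (distr (density lborel ?g) borel \<phi>) A = emeasure ?\<nu> A" ..
  qed simp
  have 2: "distr ?\<nu> borel (\<lambda>x. x) = ?\<nu>"
    by (rule distr_id2) simp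
  have sf: "sigma_finite_measure ?\<nu>"
  proof -
    have "finite_measure ?\<nu>"
      by (intro finite_measureI) (simp add: emeasure_density)
    then show ?thesis by (simp add: finite_measure.axioms)
  qed
  have id: "(\<lambda>l\<in>I. x l) = x" if "x \<in> space ?L" for x
    using that by (simp add: space_PiM PiE_restrict)
  \<comment> \<open>Stated for general \<open>f\<close> and \<open>u\<close> because it is applied
    twice: to \<open>\<phi>\<close> with its Jacobian, and to the identity with the indicator. Both
    sides of the goal then equal the same integral over the product of uniform measures.\<close>
  have eq: "(\<integral>\<^sup>+x. F (\<lambda>l\<in>I. f (x l)) * (\<Prod>l\<in>I. u (x l)) \<partial>?L) = (\<integral>\<^sup>+x. F x \<partial>(\<Pi>\<^sub>M l\<in>I. ?\<nu>))"
    if [measurable]: "f \<in> borel_measurable borel" "u \<in> borel_measurable borel"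
      and d: "distr (density lborel u) borel f = ?\<nu>" for f :: "real \<Rightarrow> real" and u :: "real \<Rightarrow> ennreal"
  proof -
    have "(\<integral>\<^sup>+x. F x \<partial>(\<Pi>\<^sub>M l\<in>I. ?\<nu>))
       = (\<integral>\<^sup>+x. F x \<partial>distr (density ?L (\<lambda>x. \<Prod>l\<in>I. u (x l))) ?L (\<lambda>x. \<lambda>l\<in>I. f (x l)))"
      by (simp only: distr_PiM_density[OF assms(1) that(2,1) d sf])
    also have "\<dots> = (\<integral>\<^sup>+x. (\<Prod>l\<in>I. u (x l)) * F (\<lambda>l\<in>I. f (x l)) \<partial>?L)"
      using assms(1) by (subst nn_integral_distr, measurable, subst nn_integral_density) auto
    finally show ?thesis by (simp add: mult.commute)
  qed
  have "(\<integral>\<^sup>+x. F x * (\<Prod>l\<in>I. ?h (x l)) \<partial>?L) = (\<integral>\<^sup>+x. F (\<lambda>l\<in>I. x l) * (\<Prod>l\<in>I. ?h (x l)) \<partial>?L)"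
    by (intro nn_integral_cong) (simp add: id)
  also have "\<dots> = (\<integral>\<^sup>+x. F x \<partial>(\<Pi>\<^sub>M l\<in>I. ?\<nu>))"
    by (rule eq[OF _ _ 2]) auto
  also have "\<dots> = (\<integral>\<^sup>+x. F (\<lambda>l\<in>I. \<phi> (x l)) * (\<Prod>l\<in>I. ?g (x l)) \<partial>?L)"
    by (rule eq[OF _ _ 1, symmetric]) auto
  finally show ?thesis .
qed

section \<open>The loop equation\<close>

text \<open>The divided difference of \<open>x ^ p * (1 - x)\<close>; the closed form keeps the diagonal \<open>x = y\<close>.\<close>

definition diff_quot :: "nat \<Rightarrow> real \<Rightarrow> real \<Rightarrow> real" where
  "diff_quot p x y = (\<Sum>s<p. x ^ s * y ^ (p - Suc s)) - (\<Sum>s<Suc p. x ^ s * y ^ (p - s))"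

lemma diff_quot_eq: "(x - y) * diff_quot p x y = (x ^ p - x ^ Suc p) - (y ^ p - y ^ Suc p)"
proof -
  have "x ^ n - y ^ n = (x - y) * (\<Sum>s<n. x ^ s * y ^ (n - Suc s))" for n
    by (simp add: power_diff_sumr2 mult.commute)
  from this[of p] this[of "Suc p"] show ?thesis
    by (simp add: diff_quot_def right_diff_distrib del: power_Suc sum.lessThan_Suc)
qed

lemma diff_quot_commute: "diff_quot p x y = diff_quot p y x"
proof -
  have 1: "(\<Sum>s<p. x ^ s * y ^ (p - Suc s)) = (\<Sum>s<p. y ^ s * x ^ (p - Suc s))"
    by (subst sum.nat_diff_reindex[symmetric]) (auto intro!: sum.cong simp: mult.commute)
  have 2: "(\<Sum>s<Suc p. x ^ s * y ^ (p - s)) = (\<Sum>s<Suc p. y ^ s * x ^ (p - s))"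
    by (subst sum.nat_diff_reindex[symmetric]) (auto intro!: sum.cong simp: mult.commute simp del: sum.lessThan_Suc)
  show ?thesis unfolding diff_quot_def 1 2 ..
qed

lemma abs_sum_le_card:
  fixes f :: "nat \<Rightarrow> real"
  assumes "\<And>s. s < n \<Longrightarrow> \<bar>f s\<bar> \<le> 1"
  shows "\<bar>\<Sum>s<n. f s\<bar> \<le> real n"
  using sum_norm_le[of "{..<n}" f "\<lambda>_. 1"] assms by simp

text \<open>The two sums have \<open>p\<close> and \<open>p + 1\<close> terms, each of modulus at
  most 1.\<close>

lemma abs_diff_quot_le:
  assumes "0 \<le> x" "x \<le> 1" "0 \<le> y" "y \<le> 1"
  shows "\<bar>diff_quot p x y\<bar> \<le> 2 * real p + 1"
proof -
  have b: "\<bar>x ^ i * y ^ j\<bar> \<le> 1" for i j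
    using assms by (auto simp: abs_mult power_le_one intro!: mult_le_one)
  have "\<bar>\<Sum>s<p. x ^ s * y ^ (p - Suc s)\<bar> \<le> real p" by (intro abs_sum_le_card b)
  moreover have "\<bar>\<Sum>s<Suc p. x ^ s * y ^ (p - s)\<bar> \<le> real (Suc p)" by (intro abs_sum_le_card b)
  ultimately show ?thesis unfolding diff_quot_def by (simp del: sum.lessThan_Suc)
qed

text \<open>On the diagonal a divided difference becomes the derivative, here that of
  \<open>x ^ p * (1 - x)\<close>.\<close>

lemma diff_quot_same: "diff_quot p x x = real p * x ^ (p - 1) - real (Suc p) * x ^ p"
proof -
  have "(\<Sum>s<p. x ^ s * x ^ (p - Suc s)) = (\<Sum>s<p. x ^ (p - 1))"
    by (intro sum.cong) (auto simp flip: power_add)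
  moreover have "(\<Sum>s<Suc p. x ^ s * x ^ (p - s)) = (\<Sum>s<Suc p. x ^ p)"
    by (intro sum.cong) (auto simp flip: power_add)
  ultimately show ?thesis
    by (simp add: diff_quot_def del: sum.lessThan_Suc)
qed

lemma abs_ln_one_plus_le:
  fixes u :: real
  assumes "\<bar>u\<bar> \<le> 1/2"
  shows "\<bar>ln (1 + u)\<bar> \<le> 2 * \<bar>u\<bar>"
proof -
  have "\<bar>ln (1 + u) - u\<bar> \<le> 2 * u\<^sup>2" using assms by (rule abs_ln_one_plus_x_minus_x_bound)
  also have "2 * u\<^sup>2 = (2 * \<bar>u\<bar>) * \<bar>u\<bar>" by (simp add: power2_eq_square)
  also have "\<dots> \<le> 1 * \<bar>u\<bar>" using assms by (intro mult_right_mono) auto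
  finally show ?thesis by linarith
qed

text \<open>Serves to dominate the difference quotients of \<open>exp (log_ratio p t x)\<close> in
  \<open>t\<close>.\<close>

lemma abs_exp_minus_one_le:
  fixes y :: real
  shows "\<bar>exp y - 1\<bar> \<le> \<bar>y\<bar> * exp \<bar>y\<bar>"
proof (cases "0 \<le> y")
  case True
  have "(1 - y) * exp y \<le> exp (- y) * exp y"
    using exp_ge_add_one_self[of "- y"] by (intro mult_right_mono) auto
  also have "\<dots> = 1" by (simp flip: exp_add)
  finally show ?thesis using True by (simp add: algebra_simps)
next
  case False
  then have "exp y \<le> 1" by simp
  then have "\<bar>exp y - 1\<bar> \<le> \<bar>y\<bar> * 1" using exp_ge_add_one_self[of y] False by linarith
  also have "\<dots> \<le> \<bar>y\<bar> * exp \<bar>y\<bar>" by (intro mult_left_mono) auto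
  finally show ?thesis .
qed

section \<open>The weight under the substitution\<close>

context jacobi_parameters
begin

text \<open>Logarithm of the factor by which the weight, including the Jacobian, changes under
  \<open>x l \<mapsto> x l + t * x l ^ p * (1 - x l)\<close> for all \<open>l\<close> at once. Moving all coordinates together keeps the
  pair interactions in divided differences, hence bounded even when the exponent of
  \<open>\<bar>x k - x j\<bar>\<close> is negative.\<close>

definition log_ratio :: "nat \<Rightarrow> real \<Rightarrow> (nat \<Rightarrow> real) \<Rightarrow> real" where
  "log_ratio p t x =
     (\<Sum>l<N. \<alpha>\<^sub>1 * ln (1 + t * (x l ^ (p - 1) * (1 - x l))) + \<alpha>\<^sub>2 * ln (1 + t * - (x l ^ p))
        + ln (1 + t * (real p * x l ^ (p - 1) - real (Suc p) * x l ^ p)))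
     + (\<Sum>k<N. \<Sum>j<k. 2 * \<alpha> / real N * ln (1 + t * diff_quot p (x k) (x j)))"

definition log_ratio_deriv :: "nat \<Rightarrow> (nat \<Rightarrow> real) \<Rightarrow> real" where
  "log_ratio_deriv p x =
     (\<Sum>l<N. \<alpha>\<^sub>1 * (x l ^ (p - 1) * (1 - x l)) + \<alpha>\<^sub>2 * - (x l ^ p)
        + (real p * x l ^ (p - 1) - real (Suc p) * x l ^ p))
     + (\<Sum>k<N. \<Sum>j<k. 2 * \<alpha> / real N * diff_quot p (x k) (x j))"

text \<open>Every logarithm vanishes at \<open>t = 0\<close>, so the chain rule factor
  \<open>exp (log_ratio p 0 x)\<close> is 1.\<close>

lemma log_ratio_has_deriv:
  "((\<lambda>t. exp (log_ratio p t x)) has_real_derivative log_ratio_deriv p x) (at 0)"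
  unfolding log_ratio_def log_ratio_deriv_def
  by (rule derivative_eq_intros refl | simp add: mult_ac)+

lemma measurable_coordinate: "l < N \<Longrightarrow> (\<lambda>x. x l) \<in> borel_measurable L"
  by (auto intro!: measurable_component_singleton)

lemma borel_measurable_diff_quot [measurable]: "(\<lambda>z. diff_quot p (fst z) (snd z)) \<in> borel_measurable (borel \<Otimes>\<^sub>M borel)"
  unfolding diff_quot_def by measurable

lemma measurable_pair_sum:
  fixes f :: "real \<Rightarrow> real \<Rightarrow> real"
  assumes "(\<lambda>z. f (fst z) (snd z)) \<in> borel_measurable (borel \<Otimes>\<^sub>M borel)"
  shows "(\<lambda>x. \<Sum>k<N. \<Sum>j<k. f (x k) (x j)) \<in> borel_measurable L"
proof (intro borel_measurable_sum)
  fix k j assume "k \<in> {..<N}" "j \<in> {..<k}"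
  then have [measurable]: "(\<lambda>x. x k) \<in> borel_measurable L" "(\<lambda>x. x j) \<in> borel_measurable L"
    by (auto intro!: measurable_coordinate)
  have "(\<lambda>x. (x k, x j)) \<in> L \<rightarrow>\<^sub>M borel \<Otimes>\<^sub>M borel" by measurable
  from measurable_compose[OF this assms] show "(\<lambda>x. f (x k) (x j)) \<in> borel_measurable L" by simp
qed

lemma borel_measurable_log_ratio [measurable]: "log_ratio p t \<in> borel_measurable L"
proof -
  have [measurable]: "(\<lambda>x. \<Sum>k<N. \<Sum>j<k. 2 * \<alpha> / real N * ln (1 + t * diff_quot p (x k) (x j))) \<in> borel_measurable L"
    by (rule measurable_pair_sum) measurable
  show ?thesis unfolding log_ratio_def by measurable
qed

lemma borel_measurable_log_ratio_deriv [measurable]: "log_ratio_deriv p \<in> borel_measurable L"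
proof -
  have [measurable]: "(\<lambda>x. \<Sum>k<N. \<Sum>j<k. 2 * \<alpha> / real N * diff_quot p (x k) (x j)) \<in> borel_measurable L"
    by (rule measurable_pair_sum) measurable
  show ?thesis unfolding log_ratio_deriv_def by measurable
qed

text \<open>The three expressions are the coefficients of \<open>t\<close> in the factors gained by
  \<open>y\<close>, by \<open>1 - y\<close> and by the volume element. Sharing the bound of
  \<open>diff_quot\<close>, they are all controlled by a single smallness condition on
  \<open>t\<close>.\<close>

lemma abs_perturbation_le:
  fixes y :: real
  assumes "0 \<le> y" "y \<le> 1"
  shows "\<bar>y ^ (p - 1) * (1 - y)\<bar> \<le> 2 * real p + 1" "\<bar>- (y ^ p)\<bar> \<le> 2 * real p + 1"
    "\<bar>real p * y ^ (p - 1) - real (Suc p) * y ^ p\<bar> \<le> 2 * real p + 1"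
proof -
  have b: "0 \<le> y ^ n" "y ^ n \<le> 1" for n using assms by (auto simp: power_le_one)
  have "y ^ (p - 1) * (1 - y) \<le> 1" using assms b by (intro mult_le_one) auto
  then show "\<bar>y ^ (p - 1) * (1 - y)\<bar> \<le> 2 * real p + 1" using assms b by (simp add: abs_mult)
  show "\<bar>- (y ^ p)\<bar> \<le> 2 * real p + 1" using b[of p] by simp
  have diff_le: "\<bar>u - v\<bar> \<le> 2 * real p + 1"
    if "0 \<le> u" "u \<le> real p * 1" "0 \<le> v" "v \<le> real (Suc p) * 1" for u v
    using that by auto
  have "0 \<le> real p * y ^ (p - 1)" "real p * y ^ (p - 1) \<le> real p * 1"
    "0 \<le> real (Suc p) * y ^ p" "real (Suc p) * y ^ p \<le> real (Suc p) * 1"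
    using b by (intro mult_nonneg_nonneg mult_left_mono of_nat_0_le_iff; simp)+
  then show "\<bar>real p * y ^ (p - 1) - real (Suc p) * y ^ p\<bar> \<le> 2 * real p + 1"
    using diff_le[of "real p * y ^ (p - 1)" "real (Suc p) * y ^ p"] by simp
qed

text \<open>Every logarithm is at most \<open>t * (2 * K)\<close>, because the smallness of
  \<open>t\<close> keeps \<open>\<bar>t * u\<bar> \<le> 1/2\<close>. Linearity in \<open>t\<close>,
  uniformly on the cube, is what dominated convergence needs.\<close>

lemma abs_log_ratio_le:
  assumes "x \<in> cube" "0 \<le> t" "t * (2 * real p + 1) \<le> 1/2"
  defines "K \<equiv> 2 * real p + 1"
  shows "\<bar>log_ratio p t x\<bar> \<le> t * ((\<Sum>l<N. 2 * K * (\<bar>\<alpha>\<^sub>1\<bar> + \<bar>\<alpha>\<^sub>2\<bar> + 1)) + (\<Sum>k<N. \<Sum>j<k. 2 * K * \<bar>2 * \<alpha> / real N\<bar>))"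
proof -
  have b: "\<bar>ln (1 + t * u)\<bar> \<le> t * (2 * K)" if "\<bar>u\<bar> \<le> K" for u
  proof -
    have "\<bar>t * u\<bar> \<le> t * K" using that assms(2) by (simp add: abs_mult mult_left_mono)
    moreover have "t * K \<le> 1/2" using assms(3) by (simp add: K_def)
    ultimately show ?thesis using abs_ln_one_plus_le[of "t * u"] by linarith
  qed
  have bm: "\<bar>c * ln (1 + t * u)\<bar> \<le> \<bar>c\<bar> * (t * (2 * K))" if "\<bar>u\<bar> \<le> K" for c u
    using b[OF that] by (simp only: abs_mult) (intro mult_left_mono, auto)
  have x: "0 \<le> x l" "x l \<le> 1" if "l < N" for l using cubeD[OF assms(1) that] by auto
  have "\<bar>\<Sum>l<N. \<alpha>\<^sub>1 * ln (1 + t * (x l ^ (p - 1) * (1 - x l))) + \<alpha>\<^sub>2 * ln (1 + t * - (x l ^ p))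
        + ln (1 + t * (real p * x l ^ (p - 1) - real (Suc p) * x l ^ p))\<bar>
     \<le> (\<Sum>l<N. t * (2 * K * (\<bar>\<alpha>\<^sub>1\<bar> + \<bar>\<alpha>\<^sub>2\<bar> + 1)))" (is "\<bar>sum ?f _\<bar> \<le> _")
  proof (rule order_trans[OF sum_abs], rule sum_mono)
    fix l assume "l \<in> {..<N}"
    then have l: "l < N" by simp
    note P = abs_perturbation_le[OF x[OF l], of p, folded K_def]
    have "\<bar>?f l\<bar> \<le> \<bar>\<alpha>\<^sub>1\<bar> * (t * (2 * K)) + \<bar>\<alpha>\<^sub>2\<bar> * (t * (2 * K)) + t * (2 * K)"
      by (intro order_trans[OF abs_triangle_ineq] add_mono bm b P)
    then show "\<bar>?f l\<bar> \<le> t * (2 * K * (\<bar>\<alpha>\<^sub>1\<bar> + \<bar>\<alpha>\<^sub>2\<bar> + 1))" by (simp add: algebra_simps)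
  qed
  moreover have "\<bar>\<Sum>k<N. \<Sum>j<k. 2 * \<alpha> / real N * ln (1 + t * diff_quot p (x k) (x j))\<bar>
     \<le> (\<Sum>k<N. \<Sum>j<k. t * (2 * K * \<bar>2 * \<alpha> / real N\<bar>))"
  proof (rule order_trans[OF sum_abs], rule sum_mono, rule order_trans[OF sum_abs], rule sum_mono)
    fix k j assume "k \<in> {..<N}" "j \<in> {..<k}"
    then have "\<bar>diff_quot p (x k) (x j)\<bar> \<le> K"
      unfolding K_def using x by (intro abs_diff_quot_le) auto
    from bm[OF this, of "2 * \<alpha> / real N"]
    show "\<bar>2 * \<alpha> / real N * ln (1 + t * diff_quot p (x k) (x j))\<bar> \<le> t * (2 * K * \<bar>2 * \<alpha> / real N\<bar>)"
      by (simp only: mult_ac)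
  qed
  ultimately show ?thesis
    unfolding log_ratio_def distrib_left sum_distrib_left
    by (intro order_trans[OF abs_triangle_ineq] add_mono)
qed

text \<open>Under the substitution each of \<open>y\<close>, \<open>1 - y\<close>,
  \<open>y - z\<close> and the volume element is multiplied by some \<open>1 + t * u\<close> with
  \<open>\<bar>u\<bar> \<le> 2 * real p + 1\<close>. The condition on \<open>t\<close> keeps these
  factors at least \<open>1/2\<close>, so \<open>\<phi>\<close> preserves the unit interval and the
  order of points, and all logarithms are meaningful.\<close>

lemma nn_integral_w_exp_log_ratio:
  assumes p: "1 \<le> p" and t: "0 \<le> t" "t * (2 * real p + 1) \<le> 1/2"
  shows "(\<integral>\<^sup>+x. ennreal (w x * exp (log_ratio p t x)) \<partial>L) = (\<integral>\<^sup>+x. ennreal (w x) \<partial>L)"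
proof -
  define A where "A y = y ^ (p - 1) * (1 - y)" for y :: real
  define \<phi> where "\<phi> y = y * (1 + t * A y)" for y :: real
  define c where "c y = real p * y ^ (p - 1) - real (Suc p) * y ^ p" for y :: real
  \<comment> \<open>The hypothesis \<open>1 \<le> p\<close> enters here, as \<open>p - 1\<close> is
    truncated subtraction.\<close>
  have yp: "y * y ^ (p - 1) = y ^ p" for y :: real using p by (cases p) auto
  have \<phi>_alt: "\<phi> y = y + t * (y ^ p - y ^ Suc p)" for y
    by (simp add: \<phi>_def A_def algebra_simps flip: yp)
  have one_minus_\<phi>: "1 - \<phi> y = (1 - y) * (1 + t * - (y ^ p))" for y
    by (simp add: \<phi>_alt algebra_simps)
  have small: "1/2 \<le> 1 + t * u" if "\<bar>u\<bar> \<le> 2 * real p + 1" for u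
  proof -
    have "\<bar>t * u\<bar> \<le> t * (2 * real p + 1)" using that t(1) by (simp add: abs_mult mult_left_mono)
    then show ?thesis using t(2) by linarith
  qed
  have pos: "0 < 1 + t * A y" "0 < 1 + t * - (y ^ p)" "0 < 1 + t * c y" if "0 \<le> y" "y \<le> 1" for y
    using abs_perturbation_le[OF that, of p, THEN small] by (simp_all only: A_def c_def)
  have \<phi>_diff: "\<phi> y - \<phi> z = (y - z) * (1 + t * diff_quot p y z)" for y z
  proof -
    have "\<phi> y - \<phi> z = (y - z) + t * ((y ^ p - y ^ Suc p) - (z ^ p - z ^ Suc p))"
      by (simp add: \<phi>_alt algebra_simps)
    then show ?thesis by (simp only: diff_quot_eq[symmetric]) (simp add: algebra_simps)
  qed
  have pos_q: "0 < 1 + t * diff_quot p y z" if "0 \<le> y" "y \<le> 1" "0 \<le> z" "z \<le> 1" for y z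
    using small[OF abs_diff_quot_le[OF that]] by linarith
  have \<phi>_unit: "\<phi> y \<in> {0<..<1}" if "y \<in> {0<..<1}" for y
  proof -
    have "0 < \<phi> y" unfolding \<phi>_def using that pos(1)[of y] by (intro mult_pos_pos) auto
    moreover have "0 < 1 - \<phi> y" unfolding one_minus_\<phi> using that pos(2)[of y] by (intro mult_pos_pos) auto
    ultimately show ?thesis by simp
  qed
  have ind: "indicator cube x = (\<Prod>l<N. indicator {0<..<1} (x l) :: ennreal)" if "x \<in> space L" for x
    using that by (auto simp: indicator_def PiE_iff space_PiM prod_zero_iff)
  let ?\<phi> = "\<lambda>x. \<lambda>l\<in>{..<N}. \<phi> (x l)"
  \<comment> \<open>Writing each factor as \<open>exp (ln (1 + t * u))\<close>, multiplied in the
    exponent by the power it carries, collects all changes into one exponential.\<close>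
  have w_\<phi>: "w (?\<phi> x) * (\<Prod>l<N. 1 + t * c (x l)) = w x * exp (log_ratio p t x)" if x: "x \<in> cube" for x
  proof -
    have xl: "0 < x l" "x l < 1" if "l < N" for l using cubeD[OF x that] by auto
    have \<phi>x: "?\<phi> x \<in> cube" using \<phi>_unit xl by (auto simp: PiE_iff)
    have "w (?\<phi> x) * (\<Prod>l<N. 1 + t * c (x l)) =
       (\<Prod>l<N. \<phi> (x l) powr \<alpha>\<^sub>1 * (1 - \<phi> (x l)) powr \<alpha>\<^sub>2 * (1 + t * c (x l))) *
       (\<Prod>k<N. \<Prod>j<k. \<bar>\<phi> (x k) - \<phi> (x j)\<bar> powr (2 * \<alpha> / real N))"
      unfolding w_eq_on_cube[OF \<phi>x] by (simp add: prod.distrib)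
    also have "(\<Prod>l<N. \<phi> (x l) powr \<alpha>\<^sub>1 * (1 - \<phi> (x l)) powr \<alpha>\<^sub>2 * (1 + t * c (x l)))
      = (\<Prod>l<N. x l powr \<alpha>\<^sub>1 * (1 - x l) powr \<alpha>\<^sub>2 * exp (\<alpha>\<^sub>1 * ln (1 + t * A (x l))
          + \<alpha>\<^sub>2 * ln (1 + t * - (x l ^ p)) + ln (1 + t * c (x l))))"
    proof (intro prod.cong refl)
      fix l assume "l \<in> {..<N}"
      then have l: "0 < x l" "x l < 1" "0 \<le> x l" "x l \<le> 1" using xl[of l] by auto
      note P = pos[OF l(3,4)]
      have "\<phi> (x l) powr \<alpha>\<^sub>1 = x l powr \<alpha>\<^sub>1 * exp (\<alpha>\<^sub>1 * ln (1 + t * A (x l)))"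
        unfolding \<phi>_def using l P by (subst powr_mult) (auto simp: powr_def)
      moreover have "(1 - \<phi> (x l)) powr \<alpha>\<^sub>2 = (1 - x l) powr \<alpha>\<^sub>2 * exp (\<alpha>\<^sub>2 * ln (1 + t * - (x l ^ p)))"
        unfolding one_minus_\<phi> using l P by (subst powr_mult) (auto simp: powr_def)
      ultimately show "\<phi> (x l) powr \<alpha>\<^sub>1 * (1 - \<phi> (x l)) powr \<alpha>\<^sub>2 * (1 + t * c (x l)) =
        x l powr \<alpha>\<^sub>1 * (1 - x l) powr \<alpha>\<^sub>2 * exp (\<alpha>\<^sub>1 * ln (1 + t * A (x l))
          + \<alpha>\<^sub>2 * ln (1 + t * - (x l ^ p)) + ln (1 + t * c (x l)))"
        using P(3) by (simp only: exp_add exp_ln mult_ac)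
    qed
    also have "(\<Prod>k<N. \<Prod>j<k. \<bar>\<phi> (x k) - \<phi> (x j)\<bar> powr (2 * \<alpha> / real N)) =
       (\<Prod>k<N. \<Prod>j<k. \<bar>x k - x j\<bar> powr (2 * \<alpha> / real N) * exp (2 * \<alpha> / real N * ln (1 + t * diff_quot p (x k) (x j))))"
    proof (intro prod.cong refl)
      fix k j assume "k \<in> {..<N}" "j \<in> {..<k}"
      then have q: "0 < 1 + t * diff_quot p (x k) (x j)"
        using xl[of k] xl[of j] by (intro pos_q) auto
      then have "\<bar>\<phi> (x k) - \<phi> (x j)\<bar> = \<bar>x k - x j\<bar> * (1 + t * diff_quot p (x k) (x j))"
        by (simp add: \<phi>_diff abs_mult)
      then show "\<bar>\<phi> (x k) - \<phi> (x j)\<bar> powr (2 * \<alpha> / real N) =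
          \<bar>x k - x j\<bar> powr (2 * \<alpha> / real N) * exp (2 * \<alpha> / real N * ln (1 + t * diff_quot p (x k) (x j)))"
        using q by (simp only:) (subst powr_mult, auto simp: powr_def)
    qed
    finally show ?thesis
      unfolding w_eq_on_cube[OF x] log_ratio_def A_def c_def
      by (simp only: prod.distrib exp_add exp_sum finite_lessThan mult_ac)
  qed
  have [measurable]: "\<phi> \<in> borel_measurable borel" "(\<lambda>y. 1 + t * c y) \<in> borel_measurable borel"
    unfolding \<phi>_def A_def c_def by measurable
  have "(\<integral>\<^sup>+x. ennreal (w x) \<partial>L) = (\<integral>\<^sup>+x. ennreal (w x) * (\<Prod>l\<in>{..<N}. indicator {0<..<1} (x l)) \<partial>L)"
  proof (intro nn_integral_cong)
    fix x assume x: "x \<in> space L"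
    have "ennreal (w x) = ennreal (w x) * indicator cube x"
      by (cases "x \<in> cube") (simp_all add: w_outside)
    then show "ennreal (w x) = ennreal (w x) * (\<Prod>l\<in>{..<N}. indicator {0<..<1} (x l))"
      by (simp only: ind[OF x])
  qed
  also have "\<dots> = (\<integral>\<^sup>+x. ennreal (w (?\<phi> x)) *
      (\<Prod>l\<in>{..<N}. ennreal (1 + t * c (x l)) * indicator {0<..<1} (x l)) \<partial>L)"
  proof (rule nn_integral_unit_cube_substitution)
    show "(\<phi> has_real_derivative 1 + t * c y) (at y)" for y
      unfolding \<phi>_alt[abs_def] c_def
      by (rule derivative_eq_intros refl | simp)+
    show "continuous_on {0..1} (\<lambda>y. 1 + t * c y)"
      unfolding c_def by (intro continuous_intros)
    show "0 \<le> 1 + t * c y" if "y \<in> {0..1}" for y using pos(3)[of y] that by auto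
    show "\<phi> 0 = 0" "\<phi> 1 = 1" by (simp_all add: \<phi>_def A_def)
  qed (use \<phi>_unit in auto)
  also have "\<dots> = (\<integral>\<^sup>+x. ennreal (w x * exp (log_ratio p t x)) \<partial>L)"
  proof (intro nn_integral_cong)
    fix x assume x: "x \<in> space L"
    have "(\<Prod>l\<in>{..<N}. ennreal (1 + t * c (x l)) * indicator {0<..<1} (x l))
      = (\<Prod>l\<in>{..<N}. ennreal (1 + t * c (x l))) * indicator cube x"
      by (simp add: prod.distrib ind[OF x])
    also have "ennreal (w (?\<phi> x)) * \<dots> = ennreal (w x * exp (log_ratio p t x))"
    proof (cases "x \<in> cube")
      case True
      have "0 \<le> 1 + t * c (x l)" if "l < N" for l using pos(3)[of "x l"] cubeD[OF True that] by auto
      then have "(\<Prod>l<N. ennreal (1 + t * c (x l))) = ennreal (\<Prod>l<N. 1 + t * c (x l))"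
        by (intro prod_ennreal) auto
      then show ?thesis using True by (simp add: w_\<phi>[OF True, symmetric] ennreal_mult')
    qed (simp add: w_outside)
    finally show "ennreal (w (?\<phi> x)) * (\<Prod>l\<in>{..<N}. ennreal (1 + t * c (x l)) * indicator {0<..<1} (x l))
      = ennreal (w x * exp (log_ratio p t x))" .
  qed
  finally show ?thesis ..
qed

text \<open>The integral of \<open>w x * exp (log_ratio p t x)\<close> does not change with
  \<open>t\<close>, so its difference quotients vanish; dominated convergence moves the limit
  \<open>t \<rightarrow> 0\<close> inside.\<close>

lemma integral_w_log_ratio_deriv:
  assumes p: "1 \<le> p"
  shows "(LINT x|L. w x * log_ratio_deriv p x) = 0"
proof -
  define K where "K = 2 * real p + 1"
  define M where "M = (\<Sum>l<N. 2 * K * (\<bar>\<alpha>\<^sub>1\<bar> + \<bar>\<alpha>\<^sub>2\<bar> + 1)) + (\<Sum>k<N. \<Sum>j<k. 2 * K * \<bar>2 * \<alpha> / real N\<bar>)"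
  \<comment> \<open>Positive step sizes tending to 0, starting at the largest value that satisfies
    \<open>t * K \<le> 1/2\<close>.\<close>
  define t where "t n = 1 / (2 * K) / real (Suc n)" for n
  have K: "1 \<le> K" by (simp add: K_def)
  have M: "0 \<le> M" using K unfolding M_def by (intro add_nonneg_nonneg sum_nonneg mult_nonneg_nonneg) auto
  have t: "0 < t n" "t n * K \<le> 1/2" "t n \<le> 1" for n
  proof -
    show "0 < t n" using K by (simp add: t_def)
    have "t n * K = (1/2) / real (Suc n)" using K by (simp add: t_def)
    also have "\<dots> \<le> (1/2) / 1" by (intro divide_left_mono) auto
    finally show *: "t n * K \<le> 1/2" by simp
    have "t n * 1 \<le> t n * K" using K \<open>0 < t n\<close> by (intro mult_left_mono) auto
    then show "t n \<le> 1" using * by simp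
  qed
  let ?s = "\<lambda>n x. w x * ((exp (log_ratio p (t n) x) - 1) / t n)"
  have zero: "(LINT x|L. ?s n x) = 0" for n
  proof -
    have eq: "(\<integral>\<^sup>+x. ennreal (w x * exp (log_ratio p (t n) x)) \<partial>L) = (\<integral>\<^sup>+x. ennreal (w x) \<partial>L)"
      using t[of n] p by (intro nn_integral_w_exp_log_ratio) (auto simp: K_def)
    \<comment> \<open>Integrability is inherited from the weight through the equality of the
      nonnegative integrals.\<close>
    have int: "integrable L (\<lambda>x. w x * exp (log_ratio p (t n) x))"
      using nn_integral_w_finite by (intro integrableI_nonneg) (auto simp: eq)
    have "(LINT x|L. w x * exp (log_ratio p (t n) x)) = Z"
      using eq by (simp add: integral_eq_nn_integral)
    then have "(LINT x|L. (w x * exp (log_ratio p (t n) x) - w x) / t n) = 0"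
      using int integrable_w by simp
    then show ?thesis by (simp add: right_diff_distrib)
  qed
  have "(\<lambda>n. LINT x|L. ?s n x) \<longlonglongrightarrow> (LINT x|L. w x * log_ratio_deriv p x)"
  proof (rule integral_dominated_convergence)
    \<comment> \<open>On the cube \<open>y = log_ratio p (t n) x\<close> satisfies
      \<open>\<bar>y\<bar> \<le> t n * M \<le> M\<close>, hence
      \<open>\<bar>exp y - 1\<bar> \<le> t n * (M * exp M)\<close>; dividing by \<open>t n\<close>
      leaves a bound free of \<open>n\<close>.\<close>
    show "integrable L (\<lambda>x. w x * (M * exp M))" using integrable_w by simp
    show "AE x in L. (\<lambda>n. ?s n x) \<longlonglongrightarrow> w x * log_ratio_deriv p x"
    proof (intro AE_I2 tendsto_mult tendsto_const)
      fix x
      have "t \<longlonglongrightarrow> 0"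
        unfolding t_def[abs_def] by (rule LIMSEQ_Suc[OF lim_const_over_n])
      then have "filterlim t (at 0) sequentially"
        using t(1) by (intro filterlim_atI) (auto intro!: always_eventually simp: less_imp_neq[symmetric])
      moreover have "((\<lambda>h. (exp (log_ratio p h x) - 1) / h) \<longlongrightarrow> log_ratio_deriv p x) (at 0)"
        using log_ratio_has_deriv[of p x] by (simp add: DERIV_def log_ratio_def)
      ultimately show "(\<lambda>n. (exp (log_ratio p (t n) x) - 1) / t n) \<longlonglongrightarrow> log_ratio_deriv p x"
        by (rule filterlim_compose[rotated])
    qed
    show "AE x in L. norm (?s n x) \<le> w x * (M * exp M)" for n
    proof (intro AE_I2)
      fix x
      show "norm (?s n x) \<le> w x * (M * exp M)"
      proof (cases "x \<in> cube")
        case True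
        let ?y = "log_ratio p (t n) x"
        have y: "\<bar>?y\<bar> \<le> t n * M"
          unfolding M_def K_def using t[of n] True by (intro abs_log_ratio_le) (auto simp: K_def)
        also have "\<dots> \<le> 1 * M" using M t(3)[of n] by (intro mult_right_mono) auto
        finally have "\<bar>?y\<bar> * exp \<bar>?y\<bar> \<le> (t n * M) * exp M"
          using y M t[of n] by (intro mult_mono) auto
        then have "\<bar>exp ?y - 1\<bar> \<le> t n * (M * exp M)"
          using abs_exp_minus_one_le[of ?y] by (simp add: mult_ac)
        then have "\<bar>(exp ?y - 1) / t n\<bar> \<le> M * exp M"
          using t(1)[of n] by (simp add: abs_divide divide_le_eq mult.commute)
        then show ?thesis by (simp only: real_norm_def abs_mult) (intro mult_mono, auto)
      qed (simp add: w_outside)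
    qed
  qed measurable
  then have "(\<lambda>n. 0) \<longlonglongrightarrow> (LINT x|L. w x * log_ratio_deriv p x)" unfolding zero .
  then show ?thesis by (rule LIMSEQ_unique) (rule tendsto_const)
qed

section \<open>The loop equation in terms of power sums\<close>

text \<open>The full square meets each off-diagonal pair twice. The subtracted diagonal becomes the
  linear terms inside the \<open>\<alpha> / real N\<close> bracket of the loop equation.\<close>

lemma sum_pairs_symmetric:
  fixes f :: "nat \<Rightarrow> nat \<Rightarrow> real"
  assumes "\<And>j k. f j k = f k j"
  shows "2 * (\<Sum>k<n. \<Sum>j<k. f k j) = (\<Sum>k<n. \<Sum>j<n. f k j) - (\<Sum>k<n. f k k)"
proof (induction n)
  case (Suc n)
  have "(\<Sum>k<n. f k n) = (\<Sum>k<n. f n k)" using assms by simp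
  then show ?case using Suc.IH by (simp add: sum.distrib algebra_simps)
qed simp

text \<open>Monomials summed over one coordinate give power sums, and the double sum of a divided
  difference gives products of two power sums.\<close>

lemma log_ratio_deriv_eq_power_stat:
  assumes p: "1 \<le> p"
  shows "log_ratio_deriv p x =
    (\<alpha>\<^sub>1 + real p) * power_stat N (p - 1) x - (\<alpha>\<^sub>1 + \<alpha>\<^sub>2 + real p + 1) * power_stat N p x
    + \<alpha> / real N * ((\<Sum>s<p. power_stat N s x * power_stat N (p - Suc s) x)
        - (\<Sum>s<Suc p. power_stat N s x * power_stat N (p - s) x)
        - real p * power_stat N (p - 1) x + real (Suc p) * power_stat N p x)"
proof -
  have S: "(\<Sum>k<N. c * x k ^ i) = c * power_stat N i x" for c i
    by (simp add: power_stat_def sum_distrib_left)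
  have yp: "y ^ (p - 1) * (1 - y) = y ^ (p - 1) - y ^ p" for y :: real
    using p by (cases p) (auto simp: algebra_simps)
  have PP: "power_stat N i x * power_stat N j x = (\<Sum>k<N. \<Sum>l<N. x k ^ i * x l ^ j)" for i j
    by (simp add: power_stat_def sum_product)
  \<comment> \<open>Once the sum over \<open>s\<close> is moved outside, the double sum over
    coordinates factorises.\<close>
  have "(\<Sum>k<N. \<Sum>j<N. diff_quot p (x k) (x j)) =
    (\<Sum>s<p. power_stat N s x * power_stat N (p - Suc s) x) - (\<Sum>s<Suc p. power_stat N s x * power_stat N (p - s) x)"
    unfolding diff_quot_def PP sum_subtractf
    by (subst (1 2 3 4) sum.swap[of _ "{..<N}"]) (simp only: sum.swap[of _ "{..<N}" "{..<p}"] sum.swap[of _ "{..<N}" "{..<Suc p}"])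
  moreover have "(\<Sum>k<N. diff_quot p (x k) (x k)) = real p * power_stat N (p - 1) x - real (Suc p) * power_stat N p x"
    by (simp only: diff_quot_same sum_subtractf S)
  ultimately have "2 * (\<Sum>k<N. \<Sum>j<k. diff_quot p (x k) (x j)) =
     (\<Sum>s<p. power_stat N s x * power_stat N (p - Suc s) x) - (\<Sum>s<Suc p. power_stat N s x * power_stat N (p - s) x)
     - real p * power_stat N (p - 1) x + real (Suc p) * power_stat N p x"
    using sum_pairs_symmetric[of "\<lambda>k j. diff_quot p (x k) (x j)" N] by (simp add: diff_quot_commute)
  moreover have "(\<Sum>k<N. \<Sum>j<k. 2 * \<alpha> / real N * diff_quot p (x k) (x j))
      = \<alpha> / real N * (2 * (\<Sum>k<N. \<Sum>j<k. diff_quot p (x k) (x j)))"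
    by (simp add: sum_distrib_left mult_ac)
  moreover have "(\<Sum>l<N. \<alpha>\<^sub>1 * (x l ^ (p - 1) * (1 - x l)) + \<alpha>\<^sub>2 * - (x l ^ p)
        + (real p * x l ^ (p - 1) - real (Suc p) * x l ^ p))
      = (\<alpha>\<^sub>1 + real p) * power_stat N (p - 1) x - (\<alpha>\<^sub>1 + \<alpha>\<^sub>2 + real p + 1) * power_stat N p x"
  proof -
    have "\<alpha>\<^sub>1 * (x l ^ (p - 1) * (1 - x l)) + \<alpha>\<^sub>2 * - (x l ^ p)
        + (real p * x l ^ (p - 1) - real (Suc p) * x l ^ p)
      = (\<alpha>\<^sub>1 + real p) * x l ^ (p - 1) - (\<alpha>\<^sub>1 + \<alpha>\<^sub>2 + real p + 1) * x l ^ p" for l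
      unfolding yp by (simp add: algebra_simps)
    then show ?thesis by (simp only: sum_subtractf S)
  qed
  ultimately show ?thesis unfolding log_ratio_deriv_def by (simp only:)
qed

lemma borel_measurable_power_stat [measurable]: "power_stat N p \<in> borel_measurable L"
  unfolding power_stat_def by measurable

lemma abs_power_stat_le: "x \<in> cube \<Longrightarrow> \<bar>power_stat N p x\<bar> \<le> real N"
  unfolding power_stat_def using cubeD[of x]
  by (intro abs_sum_le_card) (auto simp: power_le_one less_imp_le)

lemma integrable_power_stat: "integrable J (power_stat N p)"
  by (rule integrable_J_bounded[OF borel_measurable_power_stat abs_power_stat_le])

lemma integrable_power_stat_mult: "integrable J (\<lambda>x. power_stat N p x * power_stat N q x)"
proof (rule integrable_J_bounded)
  show "\<bar>power_stat N p x * power_stat N q x\<bar> \<le> real N * real N" if "x \<in> cube" for x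
    unfolding abs_mult using that by (intro mult_mono abs_power_stat_le) auto
qed measurable

text \<open>Dividing the vanishing integral of \<open>log_ratio_deriv\<close> by \<open>Z\<close>
  turns it into an identity of expectations, exact at each positive \<open>N\<close>.\<close>

lemma loop_equation:
  assumes p: "1 \<le> p"
  defines "E \<equiv> \<lambda>s. LINT x|J. power_stat N s x"
    and "E2 \<equiv> \<lambda>s r. LINT x|J. power_stat N s x * power_stat N r x"
  shows "(\<alpha>\<^sub>1 + real p) * E (p - 1) - (\<alpha>\<^sub>1 + \<alpha>\<^sub>2 + real p + 1) * E p
    + \<alpha> / real N * ((\<Sum>s<p. E2 s (p - Suc s)) - (\<Sum>s<Suc p. E2 s (p - s))
        - real p * E (p - 1) + real (Suc p) * E p) = 0"
proof -
  have "(LINT x|J. log_ratio_deriv p x) = 0"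
    by (subst integral_J) (simp_all add: integral_w_log_ratio_deriv[OF p])
  then show ?thesis
    unfolding log_ratio_deriv_eq_power_stat[OF p] E_def E2_def
    using integrable_power_stat integrable_power_stat_mult by (simp del: sum.lessThan_Suc)
qed

end

section \<open>Cumulants and the large-N limit\<close>

lemma partition_on_singleton_iff: "partition_on {a} P \<longleftrightarrow> P = {{a}}"
proof
  assume P: "partition_on {a} P"
  have "A = {a}" if "A \<in> P" for A
  proof -
    have "A \<subseteq> {a}" "A \<noteq> {}" using partition_onD1[OF P] partition_onD3[OF P] that by auto
    then show ?thesis by blast
  qed
  moreover have "P \<noteq> {}" using partition_onD1[OF P] by auto
  ultimately show "P = {{a}}" by blast
qed (simp add: partition_on_space)

lemma partition_on_pair_iff:
  assumes "a \<noteq> b"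
  shows "partition_on {a, b} P \<longleftrightarrow> P = {{a, b}} \<or> P = {{a}, {b}}"
proof
  assume P: "partition_on {a, b} P"
  have sub: "P \<subseteq> {{a}, {b}, {a, b}}"
  proof
    fix A assume "A \<in> P"
    then have "A \<subseteq> {a, b}" "A \<noteq> {}" using partition_onD1[OF P] partition_onD3[OF P] by auto
    then show "A \<in> {{a}, {b}, {a, b}}" by blast
  qed
  have dj: "A = B" if "A \<in> P" "B \<in> P" "c \<in> A" "c \<in> B" for A B c
    using partition_onD2[OF P] that by (auto simp: disjoint_def)
  have cov: "\<exists>A\<in>P. a \<in> A" "\<exists>A\<in>P. b \<in> A" using partition_onD1[OF P] by auto
  show "P = {{a, b}} \<or> P = {{a}, {b}}"
  proof (cases "{a, b} \<in> P")
    case True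
    then have "A = {a, b}" if "A \<in> P" for A
      using sub that dj[OF that True, of a] dj[OF that True, of b] by blast
    then show ?thesis using True by blast
  next
    case False
    then have "{a} \<in> P" "{b} \<in> P" using cov sub assms by blast+
    then show ?thesis using sub False by blast
  qed
next
  assume "P = {{a, b}} \<or> P = {{a}, {b}}"
  then show "partition_on {a, b} P"
    using assms by (auto simp: partition_on_def disjoint_def)
qed

lemma joint_cumulant_1: "joint_cumulant M 1 X = (LINT x|M. X 0 x)"
proof -
  have "{\<pi>. partition_on {..<1::nat} \<pi>} = {{{0}}}"
    by (simp add: lessThan_Suc partition_on_singleton_iff)
  then show ?thesis by (simp add: joint_cumulant_def)
qed

text \<open>The partition \<open>{{0, 1}}\<close> has coefficient 1 and \<open>{{0}, {1}}\<close>
  has coefficient -1, so order two is the covariance and the ansatz makes covariances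
  \<open>O(N)\<close>.\<close>

lemma joint_cumulant_2:
  "joint_cumulant M 2 X = (LINT x|M. X 0 x * X 1 x) - (LINT x|M. X 0 x) * (LINT x|M. X 1 x)"
proof -
  have "{..<2::nat} = {0, 1}" by auto
  then have "{\<pi>. partition_on {..<2::nat} \<pi>} = {{{0, 1}}, {{0}, {1}}}"
    by (auto simp: partition_on_pair_iff)
  then show ?thesis
    by (simp add: joint_cumulant_def doubleton_eq_iff)
qed

section \<open>Leading coefficients and the recurrence\<close>

text \<open>Truncation at \<open>K = 0\<close> leaves an error \<open>o(N)\<close>.\<close>

lemma has_large_N_expansion_tendsto:
  assumes "has_large_N_expansion f c"
  shows "(\<lambda>N. f N / real N) \<longlonglongrightarrow> c 0"
proof -
  have "(\<lambda>N. f N - real N * c 0) \<in> o(\<lambda>N. real N)"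
    using assms[unfolded has_large_N_expansion_def, rule_format, of 0] by simp
  then have "(\<lambda>N. (f N - real N * c 0) / real N) \<longlonglongrightarrow> 0"
    by (rule smalloD_tendsto)
  then have "(\<lambda>N. (f N - real N * c 0) / real N + c 0) \<longlonglongrightarrow> 0 + c 0"
    by (intro tendsto_intros)
  moreover have "\<forall>\<^sub>F N in sequentially. (f N - real N * c 0) / real N + c 0 = f N / real N"
    using eventually_gt_at_top[of 0] by eventually_elim (simp add: field_simps)
  ultimately show ?thesis by (simp add: Lim_transform_eventually)
qed

text \<open>The equation telescopes:
  \<open>(a1 + p) * m (p - 1) - (a1 + a2 + p + 1) * m p\<close> is a first difference up to the term \<open>- a2 * m p\<close>.\<close>

lemma limit_loop_equation_solution:
  fixes m :: "nat \<Rightarrow> real"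
  assumes m0: "m 0 = 1" and p: "1 \<le> p"
    and eq: "\<And>p. 1 \<le> p \<Longrightarrow> (a1 + real p) * m (p - 1) - (a1 + a2 + real p + 1) * m p
      + a * ((\<Sum>s<p. m s * m (p - Suc s)) - (\<Sum>s<Suc p. m s * m (p - s))) = 0"
  shows "(real p + 1 + a1 + a2 + 2 * a) * m p
    = (1 + a1 + a) - a2 * (\<Sum>s=1..p-1. m s) - a * (\<Sum>s=1..p-1. m s * m (p - s))"
proof -
  \<comment> \<open>The right-hand side does not change with \<open>n\<close>: its increment is the
    hypothesis at \<open>Suc n\<close>. The constant is its value at \<open>n = 0\<close>, where
    \<open>m 0 = 1\<close>.\<close>
  have tele: "(1 + a1) + a = (a1 + real n + 1) * m n + a2 * (\<Sum>s=1..n. m s) + a * (\<Sum>s<Suc n. m s * m (n - s))" for n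
  proof (induction n)
    case 0
    then show ?case using m0 by simp
  next
    case (Suc n)
    have "(\<Sum>s<Suc n. m s * m (Suc n - Suc s)) = (\<Sum>s<Suc n. m s * m (n - s))" by simp
    then show ?case using Suc.IH eq[of "Suc n"]
      by (simp add: algebra_simps del: sum.lessThan_Suc)
  qed
  obtain n where n: "p = Suc n" using p by (cases p) auto
  \<comment> \<open>The end terms \<open>s = 0\<close> and \<open>s = p\<close> both equal
    \<open>m p\<close>; they supply the \<open>2 * a\<close> on the left of the claim.\<close>
  have "(\<Sum>s<Suc p. m s * m (p - s)) = 2 * m p + (\<Sum>s=1..p-1. m s * m (p - s))"
  proof -
    have "{..<Suc p} = insert 0 (insert p {1..p-1})" using n by auto
    then show ?thesis using n m0 by (simp add: sum.insert)
  qed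
  moreover have "(\<Sum>s=1..p. m s) = (\<Sum>s=1..p-1. m s) + m p" using n by simp
  ultimately show ?thesis using tele[of p] by (simp add: algebra_simps del: sum.lessThan_Suc)
qed

theorem mainTheorem7:
  fixes \<alpha> \<alpha>\<^sub>1 \<alpha>\<^sub>2 :: real and m :: "nat \<Rightarrow> real"
  assumes "\<alpha>\<^sub>1 > -1" and "\<alpha>\<^sub>2 > -1"
    and "\<alpha> > - Min {1, 1 + \<alpha>\<^sub>1, 1 + \<alpha>\<^sub>2}"
    and "large_N_ansatz \<alpha>\<^sub>1 \<alpha>\<^sub>2 \<alpha>"
    and "m = jacobi_limit_moment \<alpha>\<^sub>1 \<alpha>\<^sub>2 \<alpha>"
  shows "m 0 = 1 \<and>
    (\<forall>p\<ge>1. m p = 1 / (real p + 1 + \<alpha>\<^sub>1 + \<alpha>\<^sub>2 + 2 * \<alpha>) *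
        ((1 + \<alpha>\<^sub>1 + \<alpha>) - \<alpha>\<^sub>2 * (\<Sum>s=1..p-1. m s)
          - \<alpha> * (\<Sum>s=1..p-1. m s * m (p - s))))"
proof -
  have \<alpha>_gt: "- 1 < \<alpha>" "- (1 + \<alpha>\<^sub>1) < \<alpha>" "- (1 + \<alpha>\<^sub>2) < \<alpha>"
    using assms(3) by auto
  then have params: "jacobi_parameters \<alpha> \<alpha>\<^sub>1 \<alpha>\<^sub>2 N" if "0 < N" for N
    using assms(1,2) that by (intro jacobi_parameters.intro) auto
  let ?J = "\<lambda>N. jacobi_ensemble \<alpha>\<^sub>1 \<alpha>\<^sub>2 (2 * \<alpha> / real N) N"
  define E where "E s N = (LINT x|?J N. power_stat N s x)" for s N
  define E2 where "E2 s r N = (LINT x|?J N. power_stat N s x * power_stat N r x)" for s r N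
  have ansatz: "\<exists>c. has_large_N_expansion (\<lambda>N. joint_cumulant (?J N) n (\<lambda>i. power_stat N (p i))) c"
    if "1 \<le> n" for n and p :: "nat \<Rightarrow> nat"
    using assms(4) that unfolding large_N_ansatz_def by blast
  \<comment> \<open>\<open>lim\<close> can be identified only once convergence is known, which the
    ansatz for \<open>n = 1\<close> supplies.\<close>
  have E_lim: "(\<lambda>N. E s N / real N) \<longlonglongrightarrow> m s" for s
  proof -
    obtain c where "has_large_N_expansion (\<lambda>N. E s N) c"
      using ansatz[of 1 "\<lambda>_. s"] unfolding joint_cumulant_1 E_def by auto
    then have lim: "(\<lambda>N. E s N / real N) \<longlonglongrightarrow> c 0" by (rule has_large_N_expansion_tendsto)
    moreover have "m s = lim (\<lambda>N. E s N / real N)"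
      by (simp add: assms(5) jacobi_limit_moment_def E_def)
    ultimately show ?thesis using limI[OF lim] by simp
  qed
  \<comment> \<open>The covariance divided by \<open>N\<close> converges, so divided by
    \<open>N^2\<close> it vanishes and the product of the means remains.\<close>
  have E2_lim: "(\<lambda>N. E2 s r N / (real N * real N)) \<longlonglongrightarrow> m s * m r" for s r
  proof -
    let ?cov = "\<lambda>N. E2 s r N - E s N * E r N"
    obtain c where "has_large_N_expansion ?cov c"
      using ansatz[of 2 "\<lambda>i. if i = 0 then s else r"] by (auto simp: joint_cumulant_2 E_def E2_def)
    then have "(\<lambda>N. ?cov N / real N) \<longlonglongrightarrow> c 0" by (rule has_large_N_expansion_tendsto)
    then have "(\<lambda>N. ?cov N / real N * (1 / real N) + E s N / real N * (E r N / real N))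
        \<longlonglongrightarrow> c 0 * 0 + m s * m r"
      by (intro tendsto_intros E_lim lim_1_over_n)
    moreover have "?cov N / real N * (1 / real N) + E s N / real N * (E r N / real N)
        = E2 s r N / (real N * real N)" for N
      by (cases "N = 0") (simp_all add: field_simps)
    ultimately show ?thesis by simp
  qed
  have m0: "m 0 = 1"
  proof -
    \<comment> \<open>The power sum of exponent 0 is the constant \<open>N\<close>, so only the
      normalisation of the ensemble is at stake.\<close>
    have "\<forall>\<^sub>F N in sequentially. E 0 N / real N = 1"
      using eventually_gt_at_top[of 0]
    proof eventually_elim
      case (elim N)
      interpret jacobi_parameters \<alpha> \<alpha>\<^sub>1 \<alpha>\<^sub>2 N using params[OF elim] .
      show ?case using elim by (simp add: E_def power_stat_def J.prob_space)
    qed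
    then have "(\<lambda>N. E 0 N / real N) \<longlonglongrightarrow> 1" by (rule tendsto_eventually)
    then show ?thesis using E_lim LIMSEQ_unique by blast
  qed
  have limit_loop: "(\<alpha>\<^sub>1 + real p) * m (p - 1) - (\<alpha>\<^sub>1 + \<alpha>\<^sub>2 + real p + 1) * m p
      + \<alpha> * ((\<Sum>s<p. m s * m (p - Suc s)) - (\<Sum>s<Suc p. m s * m (p - s))) = 0" if p: "1 \<le> p" for p
  proof -
    \<comment> \<open>The loop equation divided by \<open>N\<close>: products of power sums come
      with \<open>1 / N^2\<close> and converge, while the diagonal terms keep an extra
      \<open>1 / N\<close> and disappear.\<close>
    let ?e = "\<lambda>s N. E s N / real N" and ?e2 = "\<lambda>s r N. E2 s r N / (real N * real N)"
    let ?F = "\<lambda>N. (\<alpha>\<^sub>1 + real p) * ?e (p - 1) N - (\<alpha>\<^sub>1 + \<alpha>\<^sub>2 + real p + 1) * ?e p N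
      + \<alpha> * ((\<Sum>s<p. ?e2 s (p - Suc s) N) - (\<Sum>s<Suc p. ?e2 s (p - s) N)
          - real p * (1 / real N) * ?e (p - 1) N + real (Suc p) * (1 / real N) * ?e p N)"
    have "?F \<longlonglongrightarrow> (\<alpha>\<^sub>1 + real p) * m (p - 1) - (\<alpha>\<^sub>1 + \<alpha>\<^sub>2 + real p + 1) * m p
      + \<alpha> * ((\<Sum>s<p. m s * m (p - Suc s)) - (\<Sum>s<Suc p. m s * m (p - s))
          - real p * 0 * m (p - 1) + real (Suc p) * 0 * m p)"
      by (intro tendsto_intros E_lim E2_lim lim_1_over_n)
    moreover have "?F \<longlonglongrightarrow> 0"
    proof (rule tendsto_eventually)
      show "\<forall>\<^sub>F N in sequentially. ?F N = 0"
        using eventually_gt_at_top[of 0]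
      proof eventually_elim
        case (elim N)
        interpret jacobi_parameters \<alpha> \<alpha>\<^sub>1 \<alpha>\<^sub>2 N using params[OF elim] .
        let ?S = "(\<Sum>s<p. E2 s (p - Suc s) N)" and ?T = "\<Sum>s<Suc p. E2 s (p - s) N"
        have "?F N = ((\<alpha>\<^sub>1 + real p) * E (p - 1) N - (\<alpha>\<^sub>1 + \<alpha>\<^sub>2 + real p + 1) * E p N
          + \<alpha> / real N * (?S - ?T - real p * E (p - 1) N + real (Suc p) * E p N)) / real N"
          unfolding sum_divide_distrib[symmetric] using elim
          by (simp add: add_divide_distrib diff_divide_distrib right_diff_distrib distrib_left
              del: sum.lessThan_Suc of_nat_Suc)
        also have "\<dots> = 0"
          using loop_equation[OF p] by (simp add: E_def E2_def del: sum.lessThan_Suc of_nat_Suc)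
        finally show ?case .
      qed
    qed
    ultimately show ?thesis using LIMSEQ_unique by fastforce
  qed
  show ?thesis
  proof (intro conjI allI impI m0)
    fix p :: nat assume p: "1 \<le> p"
    \<comment> \<open>Adding the two lower bounds \<open>- (1 + \<alpha>\<^sub>1) < \<alpha>\<close>
      and \<open>- (1 + \<alpha>\<^sub>2) < \<alpha>\<close> gives the case
      \<open>p = 1\<close>.\<close>
    have "0 < real p + 1 + \<alpha>\<^sub>1 + \<alpha>\<^sub>2 + 2 * \<alpha>" using \<alpha>_gt p by linarith
    with limit_loop_equation_solution[OF m0 p limit_loop]
    show "m p = 1 / (real p + 1 + \<alpha>\<^sub>1 + \<alpha>\<^sub>2 + 2 * \<alpha>) *
        ((1 + \<alpha>\<^sub>1 + \<alpha>) - \<alpha>\<^sub>2 * (\<Sum>s=1..p-1. m s) - \<alpha> * (\<Sum>s=1..p-1. m s * m (p - s)))"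
      by (simp add: field_simps)
  qed
qed

end
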